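(* If, for all $K\in\mathcal S$, $\Sigma_K\succeq0$ and $(A_{\mathrm{cl}},\Sigma_K^{1/2})$ is controllable, then $(\mathcal S,g)$ is a Riemannian manifold. Moreover, with $Y:\mathcal S\to M(n\times n,\mathbb R)$ the mapping $Y_K:=\mathbb L(A_{\mathrm{cl}},\Sigma_K)$, with respect to the dual coframe $(dx^{i,j})$ one has $g=g_{(i,j)(k,\ell)}\,dx^{i,j}\otimes dx^{k,\ell}$ (summation convention), where each $g_{(i,j)(k,\ell)}\in C^\infty(\mathcal S)$ satisfies $$g_{(i,j)(k,\ell)}(K)=\begin{cases}[Y_K]_{\ell,j}&\text{if } i=k,\\0&\text{otherwise.}\end{cases}$$ Furthermore, the inverse matrix $g^{(i,j)(k,\ell)}$ satisfies $$g^{(i,j)(k,\ell)}(K)=\begin{cases}[Y_K^{-1}]_{\ell,j}&\text{if } i=k,\\0&\text{otherwise.}\end{cases}$$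
   Context: $M(p\times q,\mathbb R)$ is the space of real $p\times q$ matrices and $\rho$ the spectral radius. $(A,B)$ is a stabilizable pair, $A\in M(n\times n,\mathbb R)$, $B\in M(n\times m,\mathbb R)$; $\mathcal S=\{K\in M(m\times n,\mathbb R):\rho(A+BK)<1\}$, an open subset of $M(m\times n,\mathbb R)$; $A_{\mathrm{cl}}=A+BK$. For $\rho(M)<1$, $\mathbb L(M,Z)$ is the unique solution $X$ of $X=MXM^\top+Z$. $\Sigma_1,\Sigma_2\succeq0$ are fixed symmetric matrices ($n\times n$ and $m\times m$) and $\Sigma_K=\Sigma_1+K^\top\Sigma_2K$. The global chart on $\mathcal S$ is given by the matrix entries $(x^{i,j})$, $i\in\{1,\dots,m\}$, $j\in\{1,\dots,n\}$, with coordinate frame $(\partial_{i,j})$ and dual coframe $(dx^{i,j})$; under the identification $T_K\mathcal S\cong M(m\times n,\mathbb R)$, $\partial_{i,j}$ is the matrix with $1$ in entry $(i,j)$ and $0$ elsewhere. $g$ is the covariant 2-tensor field on $\mathcal S$ defined, for vector fields $V,W$ on $\mathcal S$, by $g_K(V_K,W_K)=\mathrm{tr}[V_K^\top W_K\,\mathbb L(A_{\mathrm{cl}},\Sigma_K)]$. $[M]_{a,b}$ denotes the $(a,b)$ entry of $M$. *)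

theory Defs
  imports "HOL-Analysis.Analysis"
begin

text \<open>\<open>M(p \<times> q, \<real>)\<close> is the type \<open>real^'q^'p\<close> with entries \<open>M $ i $ j\<close>.
  Its Euclidean norm is the Frobenius norm.\<close>

subsection \<open>Matrices and linear systems\<close>

text \<open>Eigenvalues of a real matrix are complex numbers, with complex eigenvectors.\<close>

definition spectrum :: "real^'n^'n \<Rightarrow> complex set" where
  "spectrum M = {z. \<exists>v::complex^'n. v \<noteq> 0 \<and> map_matrix complex_of_real M *v v = z *s v}"

definition spectral_radius :: "real^'n^'n \<Rightarrow> real" where
  "spectral_radius M = (SUP z\<in>spectrum M. cmod z)"

definition psd :: "real^'n^'n \<Rightarrow> bool" where
  "psd M \<longleftrightarrow> transpose M = M \<and> (\<forall>x. 0 \<le> x \<bullet> (M *v x))"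

definition psd_sqrt :: "real^'n^'n \<Rightarrow> real^'n^'n" where
  "psd_sqrt M = (THE R. psd R \<and> R ** R = M)"

text \<open>Kalman's rank condition: the controllability matrix \<open>[B, AB, \<dots>, A\<^sup>n\<^sup>-\<^sup>1B]\<close> has
  rank \<open>n\<close>; its rank is the dimension of the span of its columns, cf. \<open>column_rank_def\<close>.\<close>

definition controllable :: "real^'n^'n \<Rightarrow> real^'m^'n \<Rightarrow> bool" where
  "controllable A B \<longleftrightarrow>
     dim (\<Union>k<CARD('n). columns (((\<lambda>X. A ** X) ^^ k) B)) = CARD('n)"

definition stabilizing_gains :: "real^'n^'n \<Rightarrow> real^'m^'n \<Rightarrow> (real^'n^'m) set" where
  "stabilizing_gains A B = {K. spectral_radius (A + B ** K) < 1}"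

definition stabilizable :: "real^'n^'n \<Rightarrow> real^'m^'n \<Rightarrow> bool" where
  "stabilizable A B \<longleftrightarrow> (\<exists>K. spectral_radius (A + B ** K) < 1)"

text \<open>Meaningful for \<open>spectral_radius M < 1\<close>, where the equation has exactly one solution.\<close>

definition lyap :: "real^'n^'n \<Rightarrow> real^'n^'n \<Rightarrow> real^'n^'n" where
  "lyap M Z = (THE X. X = M ** X ** transpose M + Z)"

definition Sigma_gain :: "real^'n^'n \<Rightarrow> real^'m^'m \<Rightarrow> real^'n^'m \<Rightarrow> real^'n^'n" where
  "Sigma_gain \<Sigma>1 \<Sigma>2 K = \<Sigma>1 + transpose K ** \<Sigma>2 ** K"

definition Y_map ::
  "real^'n^'n \<Rightarrow> real^'m^'n \<Rightarrow> real^'n^'n \<Rightarrow> real^'m^'m \<Rightarrow> real^'n^'m \<Rightarrow> real^'n^'n" where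
  "Y_map A B \<Sigma>1 \<Sigma>2 K = lyap (A + B ** K) (Sigma_gain \<Sigma>1 \<Sigma>2 K)"

subsection \<open>Riemannian geometry of open subsets of a Euclidean space\<close>

text \<open>For \<open>S\<close> open, \<open>Ck_on k S f\<close> says that \<open>f\<close> is \<open>k\<close> times continuously
  differentiable on \<open>S\<close>: all iterated directional derivatives up to order \<open>k\<close> are
  continuous.\<close>

primrec Ck_on :: "nat \<Rightarrow> 'a::euclidean_space set \<Rightarrow> ('a \<Rightarrow> 'b::real_normed_vector) \<Rightarrow> bool" where
  "Ck_on 0 S f \<longleftrightarrow> continuous_on S f"
| "Ck_on (Suc k) S f \<longleftrightarrow>
     (\<forall>x\<in>S. f differentiable (at x)) \<and> (\<forall>v. Ck_on k S (\<lambda>x. frechet_derivative f (at x) v))"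

definition smooth_on :: "'a::euclidean_space set \<Rightarrow> ('a \<Rightarrow> 'b::real_normed_vector) \<Rightarrow> bool" where
  "smooth_on S f \<longleftrightarrow> (\<forall>k. Ck_on k S f)"

text \<open>An open \<open>S\<close> in the Euclidean space \<open>'a\<close> is a smooth manifold with a global chart, and
  every tangent space is identified with \<open>'a\<close>. A vector field is thus a map \<open>V :: 'a \<Rightarrow> 'a\<close>
  (used on \<open>S\<close> only), and a covariant 2-tensor field assigns a bilinear form on \<open>'a\<close> to each
  point of \<open>S\<close>; it is smooth if it maps smooth vector fields to smooth functions.\<close>

definition smooth_tensor2_on :: "'a::euclidean_space set \<Rightarrow> ('a \<Rightarrow> 'a \<Rightarrow> 'a \<Rightarrow> real) \<Rightarrow> bool" where
  "smooth_tensor2_on S g \<longleftrightarrow>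
     (\<forall>x\<in>S. bilinear (g x)) \<and>
     (\<forall>V W. smooth_on S V \<longrightarrow> smooth_on S W \<longrightarrow> smooth_on S (\<lambda>x. g x (V x) (W x)))"

definition riemannian_manifold :: "'a::euclidean_space set \<Rightarrow> ('a \<Rightarrow> 'a \<Rightarrow> 'a \<Rightarrow> real) \<Rightarrow> bool" where
  "riemannian_manifold S g \<longleftrightarrow>
     open S \<and> smooth_tensor2_on S g \<and>
     (\<forall>x\<in>S. \<forall>v w. g x v w = g x w v) \<and>
     (\<forall>x\<in>S. \<forall>v. v \<noteq> 0 \<longrightarrow> 0 < g x v v)"

text \<open>Multi-indices \<open>(i,j)\<close> are elements of \<open>'m \<times> 'n\<close>. In the global chart of matrix
  entries the frame and the coframe do not depend on the base point.\<close>

definition coord_frame :: "'m \<times> 'n \<Rightarrow> real^'n^'m" where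
  "coord_frame p = (\<chi> i j. if (i, j) = p then 1 else 0)"

definition coord_coframe :: "'m \<times> 'n \<Rightarrow> real^'n^'m \<Rightarrow> real" where
  "coord_coframe p V = V $ fst p $ snd p"

lemma coord_coframe_frame: "coord_coframe p (coord_frame q) = (if p = q then 1 else 0)"
  by (simp add: coord_coframe_def coord_frame_def)

definition tensor_prod :: "('a \<Rightarrow> real) \<Rightarrow> ('a \<Rightarrow> real) \<Rightarrow> 'a \<Rightarrow> 'a \<Rightarrow> real" where
  "tensor_prod \<alpha> \<beta> V W = \<alpha> V * \<beta> W"

definition tensor_coeff ::
  "(real^'n^'m \<Rightarrow> real^'n^'m \<Rightarrow> real^'n^'m \<Rightarrow> real) \<Rightarrow> 'm \<times> 'n \<Rightarrow> 'm \<times> 'n \<Rightarrow> real^'n^'m \<Rightarrow> real" where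
  "tensor_coeff g p q K = g K (coord_frame p) (coord_frame q)"

definition coeff_matrix ::
  "(real^'n^'m \<Rightarrow> real^'n^'m \<Rightarrow> real^'n^'m \<Rightarrow> real) \<Rightarrow> real^'n^'m \<Rightarrow> real^('m \<times> 'n)^('m \<times> 'n)" where
  "coeff_matrix g K = (\<chi> p q. tensor_coeff g p q K)"

subsection \<open>The metric on the set of stabilizing gains\<close>

definition g_metric ::
  "real^'n^'n \<Rightarrow> real^'m^'n \<Rightarrow> real^'n^'n \<Rightarrow> real^'m^'m \<Rightarrow>
   real^'n^'m \<Rightarrow> real^'n^'m \<Rightarrow> real^'n^'m \<Rightarrow> real" where
  "g_metric A B \<Sigma>1 \<Sigma>2 K V W =
     trace (transpose V ** W ** lyap (A + B ** K) (Sigma_gain \<Sigma>1 \<Sigma>2 K))"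

end

theory Submission
  imports Defs "HOL-Computational_Algebra.Fundamental_Theorem_Algebra"
begin

text \<open>If \<open>\<rho>(M) < 1\<close> then \<open>M\<^sup>k \<rightarrow> 0\<close>, so a solution of \<open>X = M X M\<^sup>T\<close> vanishes and the linear operator
  \<open>X \<mapsto> X - M X M\<^sup>T\<close> is bijective. Iterating the Lyapunov equation bounds the quadratic form
  of \<open>Y = L(M, Z)\<close> from below by \<open>\<Sum>j<n. |Z\<^sup>1\<^sup>/\<^sup>2 (M\<^sup>T)\<^sup>j x|\<^sup>2\<close>, which is positive for \<open>x \<noteq> 0\<close> by
  controllability; hence \<open>tr (V\<^sup>T V Y) > 0\<close> for \<open>V \<noteq> 0\<close>. The set of stabilizing gains is open because
  the strict Lyapunov inequality for \<open>P = M\<^sup>T P M + I\<close> survives small perturbations of \<open>M\<close>.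
  Differentiating the Lyapunov equation shows that a directional derivative of \<open>L(M, Z)\<close> is
  again a solution of a Lyapunov equation with the same \<open>M\<close> and a right-hand side built from
  \<open>L(M, Z)\<close> and the data, so smoothness follows by induction on the order.\<close>

section \<open>Spectral radius and powers of a matrix\<close>

text \<open>This is \<open>p(M) v\<close> in Horner form, so that only matrix-vector products
  occur.\<close>

definition poly_act :: "complex^'n^'n \<Rightarrow> complex poly \<Rightarrow> complex^'n \<Rightarrow> complex^'n" where
  "poly_act M p v = fold_coeffs (\<lambda>a w. a *s v + M *v w) p 0"

lemma poly_act_0 [simp]: "poly_act M 0 v = 0"
  by (simp add: poly_act_def)

lemma poly_act_pCons [simp]: "poly_act M (pCons a p) v = a *s v + M *v poly_act M p v"
proof (cases "a = 0 \<and> p = 0")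
  case True
  then show ?thesis by (simp add: poly_act_def)
next
  case False
  then show ?thesis
    by (cases "a = 0") (simp_all add: poly_act_def)
qed

lemma poly_act_add: "poly_act M (p + q) v = poly_act M p v + poly_act M q v"
  by (induction p q rule: poly_induct2)
    (simp_all add: matrix_vector_right_distrib vec.scale_left_distrib)

lemma poly_act_smult: "poly_act M (smult c p) v = c *s poly_act M p v"
  by (induction p) (simp_all add: vec.scale_right_distrib vector_scalar_commute)

lemma poly_act_linear_factor:
  "poly_act M ([:-l, 1:] * q) v = M *v poly_act M q v - l *s poly_act M q v"
proof -
  have "[:-l, 1:] * q = smult (- l) q + pCons 0 q" by simp
  then show ?thesis
    by (simp only: poly_act_add poly_act_smult poly_act_pCons) simp
qed

lemma poly_act_monom: "poly_act M (monom c i) v = c *s (((*v) M ^^ i) v)"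
  by (induction i) (simp_all add: monom_0 monom_Suc vector_scalar_commute)

lemma poly_act_sum: "finite I \<Longrightarrow> poly_act M (\<Sum>i\<in>I. f i) v = (\<Sum>i\<in>I. poly_act M (f i) v)"
  by (induction I rule: finite_induct) (simp_all add: poly_act_add)

text \<open>The \<open>n + 1\<close> vectors \<open>v, M v, ..., M^n v\<close> are too many to be
  independent in dimension \<open>n\<close>, and a linear dependence among them is an annihilating
  polynomial. A repetition would spoil the count of the set, so it is treated first.\<close>

lemma ex_annihilating_poly:
  fixes M :: "complex^'n^'n"
  shows "\<exists>p. p \<noteq> 0 \<and> poly_act M p v = 0"
proof (cases "inj_on (\<lambda>i. ((*v) M ^^ i) v) {..CARD('n)}")
  case False
  then obtain i j where ij: "i \<noteq> j" "((*v) M ^^ i) v = ((*v) M ^^ j) v"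
    by (auto simp: inj_on_def)
  let ?p = "monom 1 i + monom (-1) j :: complex poly"
  have "coeff ?p i \<noteq> 0" using ij by simp
  then have "?p \<noteq> 0" by (metis coeff_0)
  moreover have "poly_act M ?p v = 0"
    by (simp add: poly_act_add poly_act_monom ij)
  ultimately show ?thesis by blast
next
  case True
  let ?w = "\<lambda>i. ((*v) M ^^ i) v"
  let ?W = "?w ` {..CARD('n)}"
  have "card ?W = CARD('n) + 1" using card_image[OF True] by simp
  then have "vec.dependent ?W"
    using vec.independent_card_le_dim[of ?W UNIV]
    by (metis add.commute le_add_same_cancel1 not_one_le_zero top_greatest vec_dim_card add_le_same_cancel1)
  then obtain u x where u: "x \<in> ?W" "u x \<noteq> 0" "(\<Sum>x\<in>?W. u x *s x) = 0"
    using vec.dependent_finite[of ?W] by auto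
  obtain i where i: "i \<le> CARD('n)" "x = ?w i" using u by auto
  let ?p = "\<Sum>i\<le>CARD('n). monom (u (?w i)) i"
  have "coeff ?p i = (\<Sum>j\<le>CARD('n). if j = i then u (?w i) else 0)"
    unfolding coeff_sum by (rule sum.cong) (auto simp: )
  also have "\<dots> = u x" using i by simp
  finally have "?p \<noteq> 0" using u by (metis coeff_0)
  moreover have "poly_act M ?p v = 0"
    using u(3) by (simp add: poly_act_sum poly_act_monom sum.reindex[OF True])
  ultimately show ?thesis by blast
qed

text \<open>Every vector is killed by a product of factors \<open>M - l\<close>, by the fundamental theorem of
  algebra. With \<open>P\<close> taken as \<open>v = 0\<close> this yields an eigenvalue, and with \<open>P\<close> taken as
  \<open>M\<^sup>k v \<rightarrow> 0\<close> it yields convergence of the powers, without any normal form.\<close>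

lemma linear_factor_induct:
  fixes M :: "complex^'n^'n"
  assumes "P 0" and step: "\<And>l u. P (M *v u - l *s u) \<Longrightarrow> P u"
  shows "P v"
proof -
  obtain p' where p': "p' \<noteq> 0" "poly_act M p' v = 0" using ex_annihilating_poly by blast
  \<comment> \<open>Being monic survives splitting off a linear factor, so at degree zero the
    polynomial is exactly \<open>1\<close> and \<open>P\<close> holds of \<open>v\<close>
    itself.\<close>
  define p where "p = smult (inverse (lead_coeff p')) p'"
  have "lead_coeff p = 1" "P (poly_act M p v)"
    using p' \<open>P 0\<close> by (simp_all add: p_def poly_act_smult)
  then show ?thesis
  proof (induction "degree p" arbitrary: p)
    case 0
    then have "p = [:1:]" by (metis degree_eq_zeroE lead_coeff_pCons(2))
    then show ?case using 0 by simp
  next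
    case (Suc d)
    then have "\<not> constant (poly p)" by (simp add: constant_degree)
    then obtain l where "poly p l = 0" using fundamental_theorem_of_algebra by blast
    then obtain q where q: "p = [:-l, 1:] * q" unfolding poly_eq_0_iff_dvd by (elim dvdE)
    have "lead_coeff q = 1" using Suc(3) unfolding q lead_coeff_mult by simp
    moreover from this have "d = degree q"
      using Suc(2) unfolding q by (subst (asm) degree_mult_eq) auto
    moreover have "P (poly_act M q v)" 
      using Suc(4) step unfolding q poly_act_linear_factor by blast
    ultimately show ?case using Suc by blast
  qed
qed

text \<open>Without eigenvalues every \<open>M - l\<close> would be injective, and the induction
  would force every complex vector to be \<open>0\<close>. It is this fact that lets a common bound
  on the eigenvalues bound \<open>spectral_radius\<close>.\<close>

lemma spectrum_nonempty: "spectrum (M :: real^'n^'n) \<noteq> {}"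
proof
  assume empty: "spectrum M = {}"
  let ?C = "map_matrix complex_of_real M"
  have "(v :: complex^'n) = 0" for v
  proof (rule linear_factor_induct[where M = ?C and P = "\<lambda>v. v = 0"])
    show "u = 0" if "?C *v u - l *s u = 0" for l u
      using that empty by (auto simp: spectrum_def)
  qed simp
  from this[of 1] show False by (simp add: vec_eq_iff)
qed

lemma norm_vector_scalar_mult: "norm (c *s v) = cmod c * norm (v :: complex^'n)"
  by (simp add: norm_vec_def norm_mult L2_set_right_distrib)

text \<open>The operator norm dominates every eigenvalue; this makes the supremum in
  \<open>spectral_radius\<close> a genuine upper bound.\<close>

lemma spectrum_bdd_above: "bdd_above (cmod ` spectrum M)"
proof
  fix r assume "r \<in> cmod ` spectrum M"
  then obtain z and v :: "complex^'a" where z: "r = cmod z" "v \<noteq> 0"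
    "map_matrix complex_of_real M *v v = z *s v"
    by (auto simp: spectrum_def)
  have "cmod z * norm v \<le> onorm ((*v) (map_matrix complex_of_real M)) * norm v"
    using onorm[OF matrix_vector_mul_bounded_linear, of "map_matrix complex_of_real M" v]
    by (simp add: z norm_vector_scalar_mult)
  then show "r \<le> onorm ((*v) (map_matrix complex_of_real M))"
    using z by simp
qed

section \<open>Convergence of matrix powers to zero\<close>

definition powers_vanish :: "('a::{semiring_1,topological_space})^'n^'n \<Rightarrow> bool" where
  "powers_vanish M \<longleftrightarrow> (\<forall>v. (\<lambda>k. ((*v) M ^^ k) v) \<longlonglongrightarrow> 0)"

lemma contractive_recurrence_tendsto_0:
  fixes r e :: "nat \<Rightarrow> real"
  assumes c: "0 \<le> c" "c < 1" and r0: "\<And>k. 0 \<le> r k"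
    and step: "\<And>k. r (Suc k) \<le> c * r k + e k" and e: "e \<longlonglongrightarrow> 0"
  shows "r \<longlonglongrightarrow> 0"
proof (rule LIMSEQ_I)
  fix \<epsilon> :: real assume \<epsilon>: "0 < \<epsilon>"
  \<comment> \<open>The factor \<open>1 - c\<close> makes \<open>\<epsilon> / 2\<close> the fixed
    point of \<open>x \<mapsto> c * x + (1 - c) * (\<epsilon> / 2)\<close>, to which the bound on
    \<open>r\<close> decays geometrically.\<close>
  then have "0 < (1 - c) * (\<epsilon> / 2)" using c by simp
  from LIMSEQ_D[OF e this] obtain N where N: "\<And>k. k \<ge> N \<Longrightarrow> \<bar>e k\<bar> < (1 - c) * (\<epsilon> / 2)"
    by auto
  have bound: "r (N + m) \<le> c ^ m * r N + \<epsilon> / 2" for m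
  proof (induction m)
    case (Suc m)
    have "r (N + Suc m) \<le> c * r (N + m) + (1 - c) * (\<epsilon> / 2)"
      using step[of "N + m"] N[of "N + m"] by simp
    also have "\<dots> \<le> c * (c ^ m * r N + \<epsilon> / 2) + (1 - c) * (\<epsilon> / 2)"
      using Suc c by (simp add: mult_left_mono)
    finally show ?case by (simp add: field_simps)
  qed (use \<epsilon> in simp)
  have "(\<lambda>m. c ^ m * r N) \<longlonglongrightarrow> 0"
    using c by (intro tendsto_mult_left_zero LIMSEQ_power_zero) simp
  from LIMSEQ_D[OF this, of "\<epsilon> / 2"] \<epsilon>
  obtain N' where N': "\<And>m. m \<ge> N' \<Longrightarrow> \<bar>c ^ m * r N\<bar> < \<epsilon> / 2" by auto
  have "norm (r k - 0) < \<epsilon>" if "k \<ge> N + N'" for k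
  proof -
    have "N' \<le> k - N" "N + (k - N) = k" using that by simp_all
    then show ?thesis using bound[of "k - N"] N'[of "k - N"] r0[of k] by simp
  qed
  then show "\<exists>n0. \<forall>k\<ge>n0. norm (r k - 0) < \<epsilon>" by blast
qed

text \<open>Induction along the factors \<open>C - l\<close>. If \<open>cmod l < 1\<close>, the
  powers at \<open>u\<close> obey a contractive recurrence driven by the powers at
  \<open>(C - l) u\<close>. Otherwise \<open>l\<close> is not an eigenvalue, and the inverse of
  \<open>C - l\<close>, which commutes with \<open>C\<close>, carries the convergence from
  \<open>(C - l) u\<close> over to \<open>u\<close>.\<close>

lemma powers_vanish_complex:
  fixes C :: "complex^'n^'n"
  assumes eig: "\<And>l v. v \<noteq> 0 \<Longrightarrow> C *v v = l *s v \<Longrightarrow> cmod l < 1"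
  shows "powers_vanish C"
  unfolding powers_vanish_def
proof
  fix v :: "complex^'n"
  let ?P = "\<lambda>v. (\<lambda>k. ((*v) C ^^ k) v) \<longlonglongrightarrow> 0"
  have add: "((*v) C ^^ k) (x + y) = ((*v) C ^^ k) x + ((*v) C ^^ k) y" for k x y
    by (induction k) (simp_all add: matrix_vector_right_distrib)
  have scale: "((*v) C ^^ k) (l *s x) = l *s ((*v) C ^^ k) x" for k l x
    by (induction k) (simp_all add: vector_scalar_commute)
  show "?P v"
  proof (rule linear_factor_induct[where M = C and P = ?P])
    have "((*v) C ^^ k) 0 = 0" for k by (induction k) simp_all
    then show "?P 0" by simp
  next
    fix l u assume w: "?P (C *v u - l *s u)"
    let ?w = "C *v u - l *s u"
    show "?P u"
    proof (cases "cmod l < 1")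
      case True
      have rec: "((*v) C ^^ Suc k) u = l *s ((*v) C ^^ k) u + ((*v) C ^^ k) ?w" for k
      proof -
        have "((*v) C ^^ Suc k) u = ((*v) C ^^ k) (l *s u + ?w)"
          by (simp add: funpow_swap1)
        then show ?thesis by (simp only: add scale)
      qed
      have "(\<lambda>k. norm (((*v) C ^^ k) u)) \<longlonglongrightarrow> 0"
      proof (rule contractive_recurrence_tendsto_0)
        show "norm (((*v) C ^^ Suc k) u) \<le>
            cmod l * norm (((*v) C ^^ k) u) + norm (((*v) C ^^ k) ?w)" for k
          unfolding rec using norm_triangle_ineq by (metis norm_vector_scalar_mult)
      qed (use True w in \<open>simp_all add: tendsto_norm_zero\<close>)
      then show ?thesis by (simp add: tendsto_norm_zero_iff)
    next
      case False
      let ?D = "C - mat l"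
      have D: "?D *v x = C *v x - l *s x" for x
        by (simp add: mat_def vec_eq_iff matrix_vector_mult_def left_diff_distrib sum_subtractf
            if_distrib[of "\<lambda>x. x * _"] cong: if_cong)
      have "x = 0" if "?D *v x = 0" for x
        using eig[of x l] False that unfolding D by auto
      then obtain N where N: "N ** ?D = mat 1"
        using matrix_left_invertible_ker[of ?D] by blast
      then have N': "?D ** N = mat 1" by (simp add: matrix_left_right_inverse)
      have comm: "N *v (C *v x) = C *v (N *v x)" for x
      proof -
        have "?D *v (C *v y) = C *v (?D *v y)" for y
          unfolding D by (simp add: matrix_vector_mult_diff_distrib vector_scalar_commute)
        from this[of "N *v x"] have "?D *v (C *v (N *v x)) = C *v x"
          by (simp add: matrix_vector_mul_assoc N')
        then have "N *v (?D *v (C *v (N *v x))) = N *v (C *v x)" by simp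
        then show ?thesis by (simp add: matrix_vector_mul_assoc N matrix_mul_assoc)
      qed
      have "((*v) C ^^ k) (N *v x) = N *v ((*v) C ^^ k) x" for k x
        by (induction k) (simp_all add: comm)
      moreover have "u = N *v ?w"
        by (metis D N matrix_vector_mul_assoc matrix_vector_mul_lid)
      ultimately have "((*v) C ^^ k) u = N *v ((*v) C ^^ k) ?w" for k by metis
      moreover have "(\<lambda>k. N *v ((*v) C ^^ k) ?w) \<longlonglongrightarrow> N *v 0"
        by (rule bounded_linear.tendsto[OF matrix_vector_mul_bounded_linear w])
      ultimately show ?thesis by simp
    qed
  qed
qed

text \<open>The powers of the complexified matrix on a real vector tend to zero, and their real
  parts are the powers of \<open>M\<close>.\<close>

lemma powers_vanish_of_spectral_radius:
  fixes M :: "real^'n^'n"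
  assumes "spectral_radius M < 1"
  shows "powers_vanish M"
  unfolding powers_vanish_def
proof
  fix v :: "real^'n"
  let ?C = "map_matrix complex_of_real M"
  define c :: "real^'n \<Rightarrow> complex^'n" where "c x = (\<chi> i. complex_of_real (x $ i))" for x
  have "cmod l < 1" if "x \<noteq> 0" "?C *v x = l *s x" for l x
  proof -
    have "l \<in> spectrum M" using that by (auto simp: spectrum_def)
    then have "cmod l \<le> spectral_radius M"
      unfolding spectral_radius_def by (rule cSUP_upper[OF _ spectrum_bdd_above])
    then show ?thesis using assms by simp
  qed
  then have "powers_vanish ?C" by (rule powers_vanish_complex)
  then have lim: "(\<lambda>k. ((*v) ?C ^^ k) (c v)) \<longlonglongrightarrow> 0" by (simp add: powers_vanish_def)
  have "?C *v c x = c (M *v x)" for x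
    by (simp add: c_def vec_eq_iff matrix_vector_mult_def map_matrix_def)
  then have "((*v) ?C ^^ k) (c v) = c (((*v) M ^^ k) v)" for k
    by (induction k) simp_all
  with lim have "(\<lambda>k. c (((*v) M ^^ k) v)) \<longlonglongrightarrow> 0" by simp
  then have "(\<lambda>k. Re (c (((*v) M ^^ k) v) $ i)) \<longlonglongrightarrow> Re ((0::complex^'n) $ i)" for i
    by (intro tendsto_Re tendsto_vec_nth)
  then show "(\<lambda>k. ((*v) M ^^ k) v) \<longlonglongrightarrow> 0"
    by (intro vec_tendstoI) (simp add: c_def)
qed

lemma inner_matrix_vector: "x \<bullet> ((M :: real^'n^'m) *v y) = (transpose M *v x) \<bullet> y"
  by (simp add: dot_lmul_matrix)

lemma inner_power_transpose:
  "x \<bullet> ((*v) M ^^ k) y = ((*v) (transpose M) ^^ k) x \<bullet> y" for M :: "real^'n^'n"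
  by (induction k arbitrary: x y) (simp_all add: inner_matrix_vector funpow_swap1 del: transpose_matrix_vector)

text \<open>The entries of \<open>(M^T)^k x\<close> are the inner products of \<open>x\<close> with
  the vectors \<open>M^k e_i\<close>.\<close>

lemma powers_vanish_transpose:
  fixes M :: "real^'n^'n"
  assumes "powers_vanish M"
  shows "powers_vanish (transpose M)"
  unfolding powers_vanish_def
proof
  fix x
  have "(\<lambda>k. x \<bullet> ((*v) M ^^ k) (axis i 1)) \<longlonglongrightarrow> x \<bullet> 0" for i
    using assms by (intro tendsto_inner tendsto_const) (simp add: powers_vanish_def)
  then show "(\<lambda>k. ((*v) (transpose M) ^^ k) x) \<longlonglongrightarrow> 0"
    by (intro vec_tendstoI) (simp add: inner_power_transpose inner_axis del: transpose_matrix_vector)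
qed

section \<open>The discrete Lyapunov equation\<close>

lemma bounded_bilinear_matrix_mult:
  "bounded_bilinear (\<lambda>(X :: real^'n^'m) (Y :: real^'p^'n). X ** Y)"
proof -
  have "linear (\<lambda>X :: real^'n^'m. X ** Y)" for Y :: "real^'p^'n"
    by (rule linearI)
      (simp_all add: vec_eq_iff matrix_matrix_mult_def distrib_right sum.distrib sum_distrib_left mult.assoc)
  moreover have "linear (\<lambda>Y :: real^'p^'n. X ** Y)" for X :: "real^'n^'m"
    by (rule linearI)
      (simp_all add: vec_eq_iff matrix_matrix_mult_def distrib_left sum.distrib sum_distrib_left mult.left_commute)
  ultimately show ?thesis
    by (simp add: bilinear_conv_bounded_bilinear [symmetric] bilinear_def)
qed

lemma bounded_bilinear_matrix_vector_mult:
  "bounded_bilinear (\<lambda>(X :: real^'n^'m) (x :: real^'n). X *v x)"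
proof -
  have "linear (\<lambda>X :: real^'n^'m. X *v x)" for x
    by (rule linearI)
      (simp_all add: matrix_vector_mult_add_rdistrib scaleR_matrix_vector_assoc)
  then show ?thesis
    by (simp add: bilinear_conv_bounded_bilinear [symmetric] bilinear_def)
qed

lemma bounded_linear_transpose: "bounded_linear (transpose :: real^'n^'m \<Rightarrow> real^'m^'n)"
  unfolding linear_conv_bounded_linear [symmetric]
  by (rule linearI) (simp_all add: vec_eq_iff transpose_def)

lemmas matrix_mult_algebra =
  bounded_bilinear.add_left[OF bounded_bilinear_matrix_mult]
  bounded_bilinear.add_right[OF bounded_bilinear_matrix_mult]
  bounded_bilinear.diff_left[OF bounded_bilinear_matrix_mult]
  bounded_bilinear.diff_right[OF bounded_bilinear_matrix_mult]
  linear_add[OF bounded_linear.linear[OF bounded_linear_transpose]]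
  linear_diff[OF bounded_linear.linear[OF bounded_linear_transpose]]

lemma inner_quadratic_form_mult:
  "y \<bullet> ((M ** X ** transpose M) *v z) = (transpose M *v y) \<bullet> (X *v (transpose M *v z))"
  for X :: "real^'n^'n" and M :: "real^'n^'m"
  by (simp only: matrix_vector_mul_assoc [symmetric] inner_matrix_vector)

section \<open>Existence, uniqueness and bounds for Lyapunov solutions\<close>

definition lyap_op :: "real^'n^'n \<Rightarrow> real^'n^'n \<Rightarrow> real^'n^'n" where
  "lyap_op M X = X - M ** X ** transpose M"

lemma linear_lyap_op: "linear (lyap_op M)"
proof -
  have "bounded_linear (\<lambda>X. X - M ** X ** transpose M)"
    by (intro bounded_linear_sub bounded_linear_ident
        bounded_linear_compose[OF bounded_bilinear.bounded_linear_left[OF bounded_bilinear_matrix_mult]]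
        bounded_bilinear.bounded_linear_right[OF bounded_bilinear_matrix_mult])
  then show ?thesis by (simp add: bounded_linear.linear lyap_op_def [abs_def])
qed

text \<open>Iterating \<open>X = M X M^T\<close> moves \<open>(M^T)^k\<close> onto both arguments of
  the form of \<open>X\<close>, where it tends to zero.\<close>

lemma inj_lyap_op:
  assumes "powers_vanish M"
  shows "inj (lyap_op M)"
proof (rule linear_injective_0[OF linear_lyap_op, THEN iffD2], intro allI impI)
  fix X assume "lyap_op M X = 0"
  then have X: "X = M ** X ** transpose M" by (simp add: lyap_op_def)
  let ?p = "\<lambda>k. (*v) (transpose M) ^^ k"
  have step: "y \<bullet> (X *v z) = (transpose M *v y) \<bullet> (X *v (transpose M *v z))" for y z
    by (subst X) (rule inner_quadratic_form_mult)
  have "y \<bullet> (X *v z) = ?p k y \<bullet> (X *v ?p k z)" for y z k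
    by (induction k) (simp_all add: step[symmetric] del: transpose_matrix_vector)
  moreover have "(\<lambda>k. ?p k y \<bullet> (X *v ?p k z)) \<longlonglongrightarrow> 0 \<bullet> (X *v 0)" for y z
    using powers_vanish_transpose[OF assms]
    by (intro tendsto_inner bounded_linear.tendsto[OF matrix_vector_mul_bounded_linear])
      (simp_all add: powers_vanish_def)
  ultimately have "y \<bullet> (X *v z) = 0" for y z
    by (simp add: LIMSEQ_const_iff)
  then have "X *v z = 0" for z by (metis inner_eq_zero_iff)
  then show "X = 0" by (metis matrix_eq matrix_vector_mult_0)
qed

text \<open>In finite dimension injectivity yields surjectivity, so the definite description in
  \<open>lyap\<close> denotes a solution.\<close>

lemma lyap_op_lyap:
  assumes "powers_vanish M"
  shows "lyap_op M (lyap M Z) = Z"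
proof -
  have eq: "X = M ** X ** transpose M + Z \<longleftrightarrow> lyap_op M X = Z" for X
    by (auto simp: lyap_op_def algebra_simps)
  have "\<exists>!X. lyap_op M X = Z"
    using inj_lyap_op[OF assms] linear_injective_imp_surjective[OF linear_lyap_op]
    by (metis injD surjD)
  then show ?thesis unfolding lyap_def eq by (rule theI')
qed

lemma lyap_eqI:
  assumes "powers_vanish M" and "lyap_op M X = Z"
  shows "lyap M Z = X"
  using assms inj_lyap_op lyap_op_lyap by (metis injD)

lemma lyap_equation:
  assumes "powers_vanish M"
  shows "lyap M Z = M ** lyap M Z ** transpose M + Z"
  using lyap_op_lyap[OF assms, of Z] by (simp add: lyap_op_def algebra_simps)

text \<open>The transpose of the solution solves the same equation, so uniqueness identifies the
  two.\<close>

lemma transpose_lyap: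
  assumes "powers_vanish M" and "transpose Z = Z"
  shows "transpose (lyap M Z) = lyap M Z"
proof (rule lyap_eqI [symmetric])
  have "lyap_op M (transpose (lyap M Z)) = transpose (lyap_op M (lyap M Z))"
    by (simp add: lyap_op_def matrix_mult_algebra matrix_transpose_mul matrix_mul_assoc)
  then show "lyap_op M (transpose (lyap M Z)) = Z"
    using assms by (simp add: lyap_op_lyap)
qed (rule assms)

text \<open>The equation telescopes: the partial sums differ from the form at \<open>x\<close> by
  the form at \<open>(M^T)^k x\<close>, which tends to zero. The case \<open>m = 0\<close> gives
  semidefiniteness, the case \<open>m = n\<close> meets the controllability matrix.\<close>

lemma lyap_quadratic_form_lower_bound:
  fixes M Z :: "real^'n^'n"
  assumes M: "powers_vanish M" and Z: "psd Z"
  defines "p \<equiv> \<lambda>j. (*v) (transpose M) ^^ j"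
  shows "(\<Sum>j<m. p j x \<bullet> (Z *v p j x)) \<le> x \<bullet> (lyap M Z *v x)"
proof -
  let ?X = "lyap M Z"
  have step: "y \<bullet> (?X *v y) = (transpose M *v y) \<bullet> (?X *v (transpose M *v y)) + y \<bullet> (Z *v y)" for y
    by (subst lyap_equation[OF M])
      (simp only: matrix_vector_mult_add_rdistrib inner_add_right inner_quadratic_form_mult)
  have tele: "x \<bullet> (?X *v x) - p k x \<bullet> (?X *v p k x) = (\<Sum>j<k. p j x \<bullet> (Z *v p j x))" for k
  proof (induction k)
    case (Suc k)
    then show ?case
      using step[of "p k x"] by (simp add: p_def del: transpose_matrix_vector)
  qed (simp add: p_def)
  have "(\<lambda>k. x \<bullet> (?X *v x) - p k x \<bullet> (?X *v p k x)) \<longlonglongrightarrow> x \<bullet> (?X *v x) - 0 \<bullet> (?X *v 0)"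
    using powers_vanish_transpose[OF M]
    by (intro tendsto_intros bounded_linear.tendsto[OF matrix_vector_mul_bounded_linear])
      (simp_all add: powers_vanish_def p_def)
  moreover have "(\<Sum>j<m. p j x \<bullet> (Z *v p j x)) \<le> x \<bullet> (?X *v x) - p k x \<bullet> (?X *v p k x)" if "k \<ge> m" for k
    unfolding tele using Z that by (intro sum_mono2) (auto simp: psd_def)
  ultimately show ?thesis
    by (intro tendsto_lowerbound[of _ _ sequentially]) (auto simp: eventually_at_top_linorder)
qed

lemma bounded_linear_lyap:
  assumes "powers_vanish M"
  shows "bounded_linear (lyap M)"
proof -
  have "linear (lyap M)"
  proof (rule linearI)
    show "lyap M (Z + W) = lyap M Z + lyap M W" for Z W
      using assms by (intro lyap_eqI) (simp_all add: linear_add[OF linear_lyap_op] lyap_op_lyap)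
    show "lyap M (c *\<^sub>R Z) = c *\<^sub>R lyap M Z" for c Z
      using assms by (intro lyap_eqI) (simp_all add: linear_cmul[OF linear_lyap_op] lyap_op_lyap)
  qed
  then show ?thesis by (simp add: linear_conv_bounded_linear)
qed

section \<open>Stabilizing gains form an open set\<close>

text \<open>The form of \<open>P\<close> is a Lyapunov function that \<open>N\<close> shrinks by the
  factor \<open>1 - c / D\<close>. Applied to the real and imaginary parts of an eigenvector this
  bounds every eigenvalue by \<open>sqrt (1 - c / D)\<close>; as the bound is uniform, the supremum
  stays below \<open>1\<close>.\<close>

lemma spectral_radius_less_1_certificate:
  fixes N P :: "real^'n^'n"
  assumes P: "psd P" and C: "\<And>x. x \<bullet> (P *v x) \<le> C * (x \<bullet> x)" and c: "0 < c"
    and dec: "\<And>x. (N *v x) \<bullet> (P *v (N *v x)) \<le> x \<bullet> (P *v x) - c * (x \<bullet> x)"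
  shows "spectral_radius N < 1"
proof -
  define q where "q x = x \<bullet> (P *v x)" for x
  \<comment> \<open>The maximum with \<open>c\<close> secures \<open>0 < D\<close>, by which
    \<open>c\<close> is divided below.\<close>
  define D where "D = max C c"
  have D: "0 < D" "q x \<le> D * (x \<bullet> x)" for x
    using c C[of x] mult_right_mono[of C D "x \<bullet> x"]
    by (auto simp: D_def q_def max_def split: if_splits intro: order_trans)
  have sym: "x \<bullet> (P *v y) = y \<bullet> (P *v x)" for x y
    using P by (metis inner_commute inner_matrix_vector psd_def)
  have contr: "q (N *v x) \<le> (1 - c / D) * q x" for x
  proof -
    have "c / D * q x \<le> c / D * (D * (x \<bullet> x))" using D c by (intro mult_left_mono) auto
    also have "\<dots> = c * (x \<bullet> x)" using D by simp
    finally show ?thesis using dec[of x] by (simp add: q_def algebra_simps)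
  qed
  have pos: "0 < q x" if "x \<noteq> 0" for x
  proof -
    have "0 \<le> q (N *v x)" using P by (simp add: q_def psd_def)
    moreover have "0 < c * (x \<bullet> x)" using c that by simp
    ultimately show ?thesis using dec[of x] by (simp add: q_def)
  qed
  have bound: "cmod l \<le> sqrt (1 - c / D)" if l: "l \<in> spectrum N" for l
  proof -
    obtain v :: "complex^'n" where v: "v \<noteq> 0" "map_matrix complex_of_real N *v v = l *s v"
      using l by (auto simp: spectrum_def)
    define a where "a = (\<chi> i. Re (v $ i))"
    define b where "b = (\<chi> i. Im (v $ i))"
    have ab: "a \<noteq> 0 \<or> b \<noteq> 0" using v(1) by (auto simp: a_def b_def vec_eq_iff complex_eq_iff)
    have e: "(\<Sum>j\<in>UNIV. complex_of_real (N $ i $ j) * v $ j) = l * v $ i" for i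
      using v(2) by (simp add: vec_eq_iff matrix_vector_mult_def map_matrix_def)
    have Na: "N *v a = Re l *\<^sub>R a - Im l *\<^sub>R b"
      using e[THEN arg_cong[where f = Re]] by (simp add: vec_eq_iff matrix_vector_mult_def a_def b_def)
    have Nb: "N *v b = Re l *\<^sub>R b + Im l *\<^sub>R a"
      using e[THEN arg_cong[where f = Im]] by (simp add: vec_eq_iff matrix_vector_mult_def a_def b_def)
    \<comment> \<open>\<open>q a + q b\<close> is the Hermitian form of \<open>P\<close> at
      \<open>v\<close>; the cross terms in \<open>a\<close> and \<open>b\<close> cancel by symmetry
      of \<open>P\<close>.\<close>
    have qs: "q (N *v a) + q (N *v b) = ((Re l)\<^sup>2 + (Im l)\<^sup>2) * (q a + q b)"
      unfolding Na Nb q_def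
      by (simp add: matrix_vector_mult_diff_distrib matrix_vector_right_distrib matrix_vector_mult_scaleR
          inner_add_left inner_add_right inner_diff_left inner_diff_right sym[of b a] power2_eq_square)
        (simp add: algebra_simps)
    have "(cmod l)\<^sup>2 * (q a + q b) \<le> (1 - c / D) * (q a + q b)"
      using contr[of a] contr[of b] qs by (simp add: cmod_power2 distrib_left)
    moreover have "0 < q a + q b"
      using ab pos[of a] pos[of b] P by (auto simp: q_def psd_def intro: add_pos_nonneg add_nonneg_pos)
    ultimately have "(cmod l)\<^sup>2 \<le> 1 - c / D" by (simp add: mult_le_cancel_right)
    then show ?thesis by (rule real_le_rsqrt)
  qed
  have "spectral_radius N \<le> sqrt (1 - c / D)"
    unfolding spectral_radius_def using spectrum_nonempty bound by (rule cSUP_least)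
  also have "\<dots> < 1" using c D by simp
  finally show ?thesis .
qed

lemma open_stabilizing_gains: "open (stabilizing_gains A (B :: real^'m^'n))"
proof (subst open_subopen, intro ballI)
  fix K assume K: "K \<in> stabilizing_gains A B"
  define M where "M = A + B ** K"
  \<comment> \<open>\<open>lyap\<close> has the transpose on the right, so a Lyapunov function for
    \<open>M\<close> comes from the equation for \<open>transpose M\<close>.\<close>
  define P where "P = lyap (transpose M) (mat 1)"
  have M: "powers_vanish (transpose M)"
    using K by (simp add: M_def stabilizing_gains_def powers_vanish_of_spectral_radius powers_vanish_transpose)
  have I: "psd (mat 1 :: real^'n^'n)" by (simp add: psd_def)
  have P: "psd P"
    unfolding psd_def P_def
    using lyap_quadratic_form_lower_bound[OF M I, where m = 0] transpose_lyap[OF M] by simp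
  have PM: "P = transpose M ** P ** M + mat 1"
    unfolding P_def using lyap_equation[OF M, of "mat 1"] by simp
  obtain C where C: "0 < C" "\<And>(X :: real^'n^'n) x. norm (X *v x) \<le> norm X * norm x * C"
    using bounded_bilinear.pos_bounded[OF bounded_bilinear_matrix_vector_mult] by blast
  have quad: "x \<bullet> (X *v x) \<le> norm X * C * (x \<bullet> x)" for X :: "real^'n^'n" and x
  proof -
    have "x \<bullet> (X *v x) \<le> norm x * norm (X *v x)" by (rule norm_cauchy_schwarz)
    also have "\<dots> \<le> norm x * (norm X * norm x * C)" by (intro mult_left_mono C) simp
    finally show ?thesis by (simp add: dot_square_norm power2_eq_square algebra_simps)
  qed
  \<comment> \<open>\<open>F L\<close> is the change of \<open>M^T P M\<close> when the gain moves
    from \<open>K\<close> to \<open>L\<close>.\<close>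
  define F where "F L = transpose (A + B ** L) ** P ** (A + B ** L) - transpose M ** P ** M" for L
  have "continuous_on UNIV F"
    unfolding F_def
    by (intro continuous_intros bounded_bilinear.continuous_on[OF bounded_bilinear_matrix_mult]
        bounded_linear.continuous_on[OF bounded_linear_transpose])
  \<comment> \<open>At \<open>K\<close> the form of \<open>P\<close> drops by
    \<open>x \<bullet> x\<close>; with the estimate \<open>quad\<close>, the radius
    \<open>1 / (2 * C)\<close> lets the perturbation spoil at most half of this drop.\<close>
  then have "open {L. norm (F L) < 1 / (2 * C)}"
    by (intro open_Collect_less continuous_intros)
  moreover have "K \<in> {L. norm (F L) < 1 / (2 * C)}"
    using C by (simp add: F_def M_def)
  moreover have "{L. norm (F L) < 1 / (2 * C)} \<subseteq> stabilizing_gains A B"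
  proof
    fix L assume "L \<in> {L. norm (F L) < 1 / (2 * C)}"
    then have L: "norm (F L) * C \<le> 1 / 2" using C by (simp add: field_simps)
    let ?N = "A + B ** L"
    have "(?N *v x) \<bullet> (P *v (?N *v x)) \<le> x \<bullet> (P *v x) - 1 / 2 * (x \<bullet> x)" for x
    proof -
      have "(?N *v x) \<bullet> (P *v (?N *v x)) = x \<bullet> ((transpose ?N ** P ** ?N) *v x)"
        using inner_quadratic_form_mult[of x "transpose ?N" P x] by simp
      also have "transpose ?N ** P ** ?N = P - mat 1 + F L"
        by (subst PM) (simp add: F_def)
      also have "x \<bullet> ((P - mat 1 + F L) *v x) = x \<bullet> (P *v x) - x \<bullet> x + x \<bullet> (F L *v x)"
        by (simp add: algebra_simps inner_add_right inner_diff_right)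
      also have "x \<bullet> (F L *v x) \<le> 1 / 2 * (x \<bullet> x)"
        using quad[of x "F L"] mult_right_mono[OF L, of "x \<bullet> x"] by simp
      finally show ?thesis by simp
    qed
    then have "spectral_radius ?N < 1"
      using spectral_radius_less_1_certificate[OF P quad, where N = ?N and c = "1 / 2"] by simp
    then show "L \<in> stabilizing_gains A B" by (simp add: stabilizing_gains_def)
  qed
  ultimately show "\<exists>T. open T \<and> K \<in> T \<and> T \<subseteq> stabilizing_gains A B" by blast
qed

section \<open>Square roots of positive semidefinite matrices\<close>

text \<open>Were \<open>w = N v\<close> nonzero, the form along \<open>v + t w\<close> would have
  the linear term \<open>2 t |w|^2\<close> and turn negative for small negative
  \<open>t\<close>.\<close>

lemma psd_quadratic_form_zero:
  assumes N: "psd N" and v: "v \<bullet> (N *v v) = 0"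
  shows "N *v v = 0"
proof -
  define w where "w = N *v v"
  define a where "a = w \<bullet> w"
  define b where "b = w \<bullet> (N *v w)"
  have b: "0 \<le> b" using N by (simp add: b_def psd_def)
  have vw: "v \<bullet> (N *v w) = a"
    using N by (simp add: inner_matrix_vector a_def w_def psd_def del: transpose_matrix_vector)
  have "0 \<le> (v + t *\<^sub>R w) \<bullet> (N *v (v + t *\<^sub>R w))" for t
    using N by (simp add: psd_def)
  also have "(v + t *\<^sub>R w) \<bullet> (N *v (v + t *\<^sub>R w)) = 2 * t * a + t\<^sup>2 * b" for t
    using v by (simp add: matrix_vector_right_distrib matrix_vector_mult_scaleR inner_add_left
        inner_add_right vw b_def flip: w_def)
      (simp add: a_def power2_eq_square algebra_simps)
  finally have nonneg: "0 \<le> 2 * t * a + t\<^sup>2 * b" for t .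
  \<comment> \<open>Adding \<open>1\<close> to \<open>b\<close> keeps the quotient meaningful for
    \<open>b = 0\<close>; at \<open>- t\<close> the quadratic then equals
    \<open>- t^2 (b + 2)\<close>.\<close>
  define t where "t = a / (b + 1)"
  have a: "a = t * (b + 1)" using b by (simp add: t_def)
  have "2 * (- t) * a + (- t)\<^sup>2 * b = - (t\<^sup>2 * (b + 2))"
    unfolding a by (simp add: power2_eq_square algebra_simps)
  then have "t\<^sup>2 * (b + 2) \<le> 0" using nonneg[of "- t"] by linarith
  then have "t = 0" using b by (simp add: mult_le_0_iff)
  then have "a = 0" using a by simp
  then show ?thesis by (simp add: a_def w_def)
qed

lemma psd_eq_0_iff_quadratic_form:
  assumes "psd M"
  shows "M = 0 \<longleftrightarrow> (\<forall>x. x \<bullet> (M *v x) = 0)"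
  using psd_quadratic_form_zero[OF assms] by (metis inner_zero_right matrix_eq matrix_vector_mult_0)

text \<open>Rayleigh's principle: if \<open>v\<close> maximises the form on the unit sphere with
  value \<open>\<mu>\<close>, then \<open>\<mu> I - M\<close> is positive semidefinite and its form
  vanishes at \<open>v\<close>, so it annihilates \<open>v\<close>.\<close>

lemma psd_ex_top_eigenvector:
  fixes M :: "real^'n^'n"
  assumes M: "psd M" and nz: "M \<noteq> 0"
  obtains \<mu> v where "0 < \<mu>" "norm v = 1" "M *v v = \<mu> *\<^sub>R v"
proof -
  have "continuous_on (sphere 0 1) (\<lambda>x. x \<bullet> (M *v x))"
    by (intro continuous_intros linear_continuous_on matrix_vector_mul_bounded_linear)
  moreover have "axis undefined 1 \<in> sphere (0 :: real^'n) 1" by simp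
  ultimately obtain v where v: "norm v = 1"
    "\<And>x. norm x = 1 \<Longrightarrow> x \<bullet> (M *v x) \<le> v \<bullet> (M *v v)"
    using continuous_attains_sup[of "sphere (0 :: real^'n) 1" "\<lambda>x. x \<bullet> (M *v x)"]
    by (auto simp: mem_sphere)
  define \<mu> where "\<mu> = v \<bullet> (M *v v)"
  have le: "x \<bullet> (M *v x) \<le> \<mu> * (x \<bullet> x)" for x
  proof (cases "x = 0")
    case False
    have "x \<bullet> (M *v x) = (norm x)\<^sup>2 * (sgn x \<bullet> (M *v sgn x))"
      using False by (simp add: sgn_div_norm matrix_vector_mult_scaleR power2_eq_square field_simps)
    also have "\<dots> \<le> (norm x)\<^sup>2 * \<mu>"
      unfolding \<mu>_def using False by (intro mult_left_mono v) (simp_all add: norm_sgn)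
    finally show ?thesis by (simp add: dot_square_norm mult.commute)
  qed simp
  have pos: "0 < \<mu>"
  proof (rule ccontr)
    assume "\<not> 0 < \<mu>"
    then have "\<mu> * (x \<bullet> x) \<le> 0" for x :: "real^'n" by (simp add: mult_nonpos_nonneg)
    then have "x \<bullet> (M *v x) = 0" for x
      using le[of x] M by (meson order_antisym order_trans psd_def)
    then show False using nz psd_eq_0_iff_quadratic_form[OF M] by blast
  qed
  let ?N = "\<mu> *\<^sub>R mat 1 - M"
  have N: "?N *v x = \<mu> *\<^sub>R x - M *v x" for x
    by (simp add: matrix_vector_mult_diff_rdistrib flip: scaleR_matrix_vector_assoc)
  have "transpose ?N = ?N"
    using M by (simp add: matrix_mult_algebra transpose_scalar psd_def)
  then have "psd ?N" using le by (simp add: psd_def N inner_diff_right)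
  moreover have "v \<bullet> (?N *v v) = 0"
    unfolding N by (simp add: inner_diff_right dot_square_norm v(1) flip: \<mu>_def)
  ultimately have "?N *v v = 0" by (rule psd_quadratic_form_zero)
  then have "M *v v = \<mu> *\<^sub>R v" by (simp add: N)
  with pos v(1) that show ?thesis by blast
qed

text \<open>For a unit vector this is the orthogonal projection onto its line.\<close>

definition outer :: "real^'n \<Rightarrow> real^'n^'n" where
  "outer v = (\<chi> i j. v $ i * v $ j)"

lemma outer_mult_vector: "outer v *v x = (v \<bullet> x) *\<^sub>R v"
  by (simp add: outer_def vec_eq_iff matrix_vector_mult_def inner_vec_def sum_distrib_left mult_ac)

lemma transpose_outer: "transpose (outer v) = outer v"
  by (simp add: outer_def transpose_def vec_eq_iff mult.commute)

lemma psd_inner_commute: "psd M \<Longrightarrow> x \<bullet> (M *v y) = y \<bullet> (M *v x)"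
  by (metis inner_commute inner_matrix_vector psd_def)

text \<open>The form of the difference at \<open>x\<close> is the form of \<open>M\<close> at the
  component of \<open>x\<close> orthogonal to \<open>v\<close>.\<close>

lemma psd_diff_top_eigenvector:
  fixes M :: "real^'n^'n"
  assumes M: "psd M" and v: "norm v = 1" "M *v v = \<mu> *\<^sub>R v"
  shows "psd (M - \<mu> *\<^sub>R outer v)"
proof -
  have "0 \<le> x \<bullet> ((M - \<mu> *\<^sub>R outer v) *v x)" for x
  proof -
    let ?y = "x - (v \<bullet> x) *\<^sub>R v"
    have "0 \<le> ?y \<bullet> (M *v ?y)" using M by (simp add: psd_def)
    also have "\<dots> = x \<bullet> (M *v x) - \<mu> * (v \<bullet> x)\<^sup>2"
      using v psd_inner_commute[OF M, of v x]
      by (simp add: matrix_vector_mult_diff_distrib matrix_vector_mult_scaleR inner_diff_left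
          inner_diff_right dot_square_norm inner_commute[of x v])
        (simp add: power2_eq_square algebra_simps)
    also have "\<dots> = x \<bullet> ((M - \<mu> *\<^sub>R outer v) *v x)"
      by (simp add: matrix_vector_mult_diff_rdistrib outer_mult_vector inner_diff_right
          inner_commute[of x v] power2_eq_square flip: scaleR_matrix_vector_assoc)
    finally show ?thesis .
  qed
  moreover have "transpose (M - \<mu> *\<^sub>R outer v) = M - \<mu> *\<^sub>R outer v"
    using M by (simp add: matrix_mult_algebra transpose_scalar transpose_outer psd_def)
  ultimately show ?thesis by (simp add: psd_def)
qed

text \<open>Deflation: subtracting the top eigenvalue's rank-one part enlarges the kernel.\<close>

lemma psd_sqrt_exists:
  fixes M :: "real^'n^'n"
  assumes "psd M"
  shows "\<exists>R. psd R \<and> R ** R = M"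
  using assms
proof (induction "CARD('n) - dim {x. M *v x = 0}" arbitrary: M rule: less_induct)
  case less
  show ?case
  proof (cases "M = 0")
    case True
    then have "psd M \<and> M ** M = M"
      using less.prems by (simp add: bounded_bilinear.zero_left[OF bounded_bilinear_matrix_mult])
    then show ?thesis by blast
  next
    case False
    then obtain \<mu> v where \<mu>: "0 < \<mu>" and v: "norm v = 1" "M *v v = \<mu> *\<^sub>R v"
      using psd_ex_top_eigenvector[OF less.prems] by blast
    have vv: "v \<bullet> v = 1" using v(1) by (simp add: dot_square_norm)
    define M' where "M' = M - \<mu> *\<^sub>R outer v"
    have M': "M' *v x = M *v x - (\<mu> * (v \<bullet> x)) *\<^sub>R v" for x
      by (simp add: M'_def matrix_vector_mult_diff_rdistrib outer_mult_vector
          flip: scaleR_matrix_vector_assoc)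
    have psd': "psd M'" unfolding M'_def by (rule psd_diff_top_eigenvector[OF less.prems v])
    have ker: "subspace {x. N *v x = 0}" for N :: "real^'n^'n"
      by (simp add: subspace_def matrix_vector_right_distrib matrix_vector_mult_scaleR)
    have M'v: "M' *v v = 0" by (simp add: M' v vv)
    have "v \<noteq> 0" using v(1) by auto
    \<comment> \<open>By symmetry \<open>\<mu> * (v \<bullet> x)\<close> vanishes on the kernel of
      \<open>M\<close>, so deflation keeps that kernel and adds \<open>v\<close> to it.\<close>
    have "M' *v x = 0" if "M *v x = 0" for x
    proof -
      have "\<mu> * (v \<bullet> x) = 0"
        using psd_inner_commute[OF less.prems, of v x] that v by (simp add: inner_commute)
      then show ?thesis using that by (simp only: M') simp
    qed
    moreover have "M *v v \<noteq> 0" using v \<mu> \<open>v \<noteq> 0\<close> by simp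
    ultimately have "{x. M *v x = 0} \<subset> {x. M' *v x = 0}" using M'v by blast
    then have "dim {x. M *v x = 0} < dim {x. M' *v x = 0}"
      using ker by (intro dim_psubset) (simp add: span_eq_iff[THEN iffD2])
    moreover have "dim {x. M' *v x = 0} \<le> CARD('n)"
      using dim_subset_UNIV[of "{x. M' *v x = 0}"] by simp
    ultimately have "\<exists>R. psd R \<and> R ** R = M'"
      using less.hyps[OF _ psd'] by simp
    then obtain R where R: "psd R" "R ** R = M'" by blast
    \<comment> \<open>Since \<open>M'\<close> kills \<open>v\<close>, so does its root
      \<open>R\<close>. In the square of \<open>?Q\<close> the cross terms then drop out, leaving
      \<open>M' + \<mu> v v^T = M\<close>.\<close>
    have "(R *v v) \<bullet> (R *v v) = v \<bullet> (M' *v v)"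
      using R psd_inner_commute[OF R(1), of "R *v v" v] by (simp add: matrix_vector_mul_assoc)
    then have Rv: "R *v v = 0" using M'v by simp
    let ?Q = "R + sqrt \<mu> *\<^sub>R outer v"
    have Q: "?Q *v x = R *v x + (sqrt \<mu> * (v \<bullet> x)) *\<^sub>R v" for x
      by (simp add: matrix_vector_mult_add_rdistrib outer_mult_vector flip: scaleR_matrix_vector_assoc)
    have vR: "v \<bullet> (R *v x) = 0" for x
      using psd_inner_commute[OF R(1), of v x] Rv by simp
    have "?Q *v (?Q *v x) = M *v x" for x
    proof -
      have "?Q *v (?Q *v x) = R *v (R *v x) + (\<mu> * (v \<bullet> x)) *\<^sub>R v"
        using \<mu> unfolding Q
        by (simp add: matrix_vector_right_distrib matrix_vector_mult_scaleR Rv inner_add_right vR vv)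
      then show ?thesis using R(2) by (simp add: matrix_vector_mul_assoc M')
    qed
    then have "?Q ** ?Q = M" by (simp add: matrix_eq flip: matrix_vector_mul_assoc)
    moreover have "transpose ?Q = ?Q"
      using R by (simp add: matrix_mult_algebra transpose_scalar transpose_outer psd_def)
    moreover have "0 \<le> x \<bullet> (?Q *v x)" for x
      using R(1) \<mu> by (simp add: Q inner_add_right psd_def inner_commute[of x v] mult.assoc)
    ultimately show ?thesis unfolding psd_def by blast
  qed
qed

text \<open>\<open>D^2\<close> is positive semidefinite and has an eigenvector \<open>v\<close> with
  eigenvalue \<open>\<mu> > 0\<close>. As \<open>(D - sqrt \<mu>) (D + sqrt \<mu>) v = 0\<close>,
  either \<open>(D + sqrt \<mu>) v\<close> is an eigenvector for \<open>sqrt \<mu>\<close>, or it is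
  zero and \<open>v\<close> is one for \<open>- sqrt \<mu>\<close>.\<close>

lemma symmetric_nonzero_ex_eigenvector:
  fixes D :: "real^'n^'n"
  assumes D: "transpose D = D" "D \<noteq> 0"
  obtains \<nu> x where "\<nu> \<noteq> 0" "x \<noteq> 0" "D *v x = \<nu> *\<^sub>R x"
proof -
  have quad: "x \<bullet> ((D ** D) *v x) = (D *v x) \<bullet> (D *v x)" for x
    using D(1) by (metis inner_matrix_vector matrix_vector_mul_assoc)
  have psd: "psd (D ** D)"
    unfolding psd_def quad by (simp add: matrix_transpose_mul D)
  moreover have "D ** D \<noteq> 0"
  proof
    assume "D ** D = 0"
    then have "D *v x = 0" for x using quad[of x] by simp
    then show False using D(2) by (metis matrix_eq matrix_vector_mult_0)
  qed
  ultimately obtain \<mu> v where \<mu>: "0 < \<mu>" and v: "norm v = 1" "(D ** D) *v v = \<mu> *\<^sub>R v"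
    using psd_ex_top_eigenvector by blast
  let ?w = "D *v v + sqrt \<mu> *\<^sub>R v"
  have "D *v ?w = sqrt \<mu> *\<^sub>R ?w"
    using v \<mu> by (simp add: matrix_vector_right_distrib matrix_vector_mult_scaleR
        matrix_vector_mul_assoc scaleR_add_right)
  moreover have "D *v v = (- sqrt \<mu>) *\<^sub>R v" if "?w = 0"
    using that by (simp add: eq_neg_iff_add_eq_0)
  ultimately show ?thesis
    using \<mu> v(1) that[of "sqrt \<mu>" ?w] that[of "- sqrt \<mu>" v] by fastforce
qed

text \<open>\<open>D = R - Q\<close> satisfies \<open>D R + Q D = 0\<close>, so an eigenvector of \<open>D\<close> with nonzero eigenvalue is
  isotropic, hence null, for both \<open>R\<close> and \<open>Q\<close>.\<close>

lemma psd_sqrt_unique: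
  fixes R Q :: "real^'n^'n"
  assumes R: "psd R" and Q: "psd Q" and eq: "R ** R = Q ** Q"
  shows "R = Q"
proof (rule ccontr)
  assume "R \<noteq> Q"
  let ?D = "R - Q"
  have "transpose ?D = ?D" using R Q by (simp add: matrix_mult_algebra psd_def)
  then obtain \<nu> x where x: "\<nu> \<noteq> 0" "x \<noteq> 0" "?D *v x = \<nu> *\<^sub>R x"
    using symmetric_nonzero_ex_eigenvector[of ?D] \<open>R \<noteq> Q\<close> by (metis right_minus_eq)
  have D: "?D *v y = R *v y - Q *v y" for y by (rule matrix_vector_mult_diff_rdistrib)
  have "R *v (R *v x) = Q *v (Q *v x)" using eq by (simp add: matrix_vector_mul_assoc)
  then have "?D *v (R *v x) + Q *v (?D *v x) = 0"
    unfolding D by (simp add: matrix_vector_mult_diff_distrib)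
  then have "x \<bullet> (?D *v (R *v x)) + x \<bullet> (Q *v (?D *v x)) = 0"
    by (metis inner_add_right inner_zero_right)
  moreover have "x \<bullet> (?D *v (R *v x)) = (?D *v x) \<bullet> (R *v x)"
    unfolding inner_matrix_vector \<open>transpose ?D = ?D\<close> ..
  ultimately have "\<nu> * (x \<bullet> (R *v x) + x \<bullet> (Q *v x)) = 0"
    unfolding x(3) by (simp add: matrix_vector_mult_scaleR distrib_left)
  then have "x \<bullet> (R *v x) + x \<bullet> (Q *v x) = 0" using x(1) by simp
  moreover have "0 \<le> x \<bullet> (R *v x)" "0 \<le> x \<bullet> (Q *v x)" using R Q by (simp_all add: psd_def)
  ultimately have "R *v x = 0" "Q *v x = 0"
    using R Q by (auto intro: psd_quadratic_form_zero)
  then show False using x by (simp add: D)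
qed

lemma psd_sqrt:
  assumes "psd M"
  shows "psd (psd_sqrt M)" "psd_sqrt M ** psd_sqrt M = M"
proof -
  have "\<exists>!R. psd R \<and> R ** R = M"
    using psd_sqrt_exists[OF assms] psd_sqrt_unique by metis
  from theI'[OF this] show "psd (psd_sqrt M)" "psd_sqrt M ** psd_sqrt M = M"
    by (simp_all add: psd_sqrt_def)
qed

section \<open>Controllability and definiteness\<close>

text \<open>If the form were not positive at \<open>x\<close>, the lower bound would force
  \<open>R (M^T)^j x = 0\<close> for all \<open>j < n\<close>, where \<open>R\<close> is the root of
  \<open>Z\<close>. Then \<open>x\<close> is orthogonal to all columns of the controllability
  matrix, which span the space.\<close>

lemma lyap_pos_def:
  fixes M Z :: "real^'n^'n"
  assumes M: "powers_vanish M" and Z: "psd Z" and contr: "controllable M (psd_sqrt Z)"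
    and "x \<noteq> 0"
  shows "0 < x \<bullet> (lyap M Z *v x)"
proof (rule ccontr)
  assume neg: "\<not> ?thesis"
  let ?R = "psd_sqrt Z"
  define p where "p j = (*v) (transpose M) ^^ j" for j
  have R: "transpose ?R = ?R" using psd_sqrt(1)[OF Z] by (simp add: psd_def)
  have quad: "y \<bullet> (Z *v y) = (?R *v y) \<bullet> (?R *v y)" for y
    using psd_sqrt(2)[OF Z] R by (metis inner_matrix_vector matrix_vector_mul_assoc)
  have "(\<Sum>j<CARD('n). p j x \<bullet> (Z *v p j x)) \<le> 0"
    using lyap_quadratic_form_lower_bound[OF M Z, where m = "CARD('n)" and x = x] neg
    by (simp add: p_def)
  then have "(\<Sum>j<CARD('n). p j x \<bullet> (Z *v p j x)) = 0"
    by (intro order_antisym sum_nonneg) (simp_all add: quad)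
  then have Rp: "?R *v p j x = 0" if "j < CARD('n)" for j
    using that by (subst (asm) sum_nonneg_eq_0_iff) (auto simp: quad)
  let ?G = "\<lambda>j. ((\<lambda>X. M ** X) ^^ j) ?R"
  have G: "?G j *v y = ((*v) M ^^ j) (?R *v y)" for j y
    by (induction j) (simp_all flip: matrix_vector_mul_assoc)
  let ?U = "\<Union>j<CARD('n). columns (?G j)"
  have "x \<bullet> u = 0" if u: "u \<in> ?U" for u
  proof -
    obtain j i where j: "j < CARD('n)" "u = column i (?G j)"
      using u by (auto simp: columns_def)
    then have "x \<bullet> u = x \<bullet> ((*v) M ^^ j) (?R *v axis i 1)"
      by (simp add: G flip: matrix_vector_mult_basis)
    also have "\<dots> = (?R *v p j x) \<bullet> axis i 1"
      using R by (metis inner_power_transpose inner_matrix_vector p_def)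
    finally show ?thesis using Rp[OF j(1)] by simp
  qed
  moreover have "span ?U = UNIV"
    using contr dim_eq_full[of ?U] by (simp add: controllable_def)
  ultimately have "orthogonal x x"
    by (intro orthogonal_to_span[of x ?U]) (auto simp: orthogonal_def)
  then show False using \<open>x \<noteq> 0\<close> by (simp add: orthogonal_def)
qed

section \<open>Functions of class \<open>C\<^sup>k\<close>\<close>

text \<open>On an open set derivatives depend only on nearby values, so agreement on
  \<open>S\<close> passes to all orders.\<close>

lemma Ck_on_cong:
  fixes f g :: "'a::euclidean_space \<Rightarrow> 'b::real_normed_vector"
  assumes "open S" and eq: "\<And>x. x \<in> S \<Longrightarrow> f x = g x" and "Ck_on k S f"
  shows "Ck_on k S g"
  using eq \<open>Ck_on k S f\<close>
proof (induction k arbitrary: f g)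
  case 0
  then show ?case by (simp cong: continuous_on_cong)
next
  case (Suc k)
  have d: "f differentiable at x" if "x \<in> S" for x using Suc.prems that by simp
  have "frechet_derivative f (at x) = frechet_derivative g (at x)" if "x \<in> S" for x
    using frechet_derivative_transform_within_open[OF d \<open>open S\<close>] that Suc.prems(1) by blast
  then have "Ck_on k S (\<lambda>x. frechet_derivative g (at x) v)" for v
    using Suc.prems(2)
    by (intro Suc.IH[where f = "\<lambda>x. frechet_derivative f (at x) v"
          and g = "\<lambda>x. frechet_derivative g (at x) v"]) simp_all
  moreover have "g differentiable at x" if x: "x \<in> S" for x
  proof -
    obtain f' where "(f has_derivative f') (at x)"
      using d[OF x] by (auto simp: differentiable_def)
    then have "(g has_derivative f') (at x)"
      by (rule has_derivative_transform_within_open[OF _ \<open>open S\<close> x Suc.prems(1)])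
    then show ?thesis by (auto simp: differentiable_def)
  qed
  ultimately show ?case by simp
qed

text \<open>This allows the derivative to be given by an explicit formula in place of
  \<open>frechet_derivative\<close>.\<close>

lemma Ck_on_SucI:
  assumes "open S" and d: "\<And>x. x \<in> S \<Longrightarrow> (f has_derivative f' x) (at x)"
    and "\<And>v. Ck_on k S (\<lambda>x. f' x v)"
  shows "Ck_on (Suc k) S f"
proof -
  have "f' x = frechet_derivative f (at x)" if "x \<in> S" for x
    using frechet_derivative_at[OF d[OF that]] .
  then have "Ck_on k S (\<lambda>x. frechet_derivative f (at x) v)" for v
    by (intro Ck_on_cong[OF \<open>open S\<close> _ assms(3)[of v]]) simp
  then show ?thesis using d by (auto simp: differentiable_def)
qed

lemma Ck_on_Suc_has_derivative:
  "Ck_on (Suc k) S f \<Longrightarrow> x \<in> S \<Longrightarrow> (f has_derivative frechet_derivative f (at x)) (at x)"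
  by (simp add: frechet_derivative_works)

text \<open>The recursion asks for continuity at the last order only; at lower orders it comes from
  differentiability.\<close>

lemma Ck_on_Suc_D: "Ck_on (Suc k) S f \<Longrightarrow> Ck_on k S f"
proof (induction k arbitrary: f)
  case 0
  then show ?case
    by (auto simp: continuous_on_eq_continuous_within
        intro: differentiable_imp_continuous_within differentiable_at_withinI)
next
  case (Suc k)
  then have "Ck_on k S (\<lambda>x. frechet_derivative f (at x) v)" for v
    by (metis Ck_on.simps(2))
  then show ?case using Suc.prems by simp
qed

lemma Ck_on_const: "open S \<Longrightarrow> Ck_on k S (\<lambda>x. c)"
proof (induction k arbitrary: c)
  case (Suc k)
  then show ?case by (intro Ck_on_SucI[where f' = "\<lambda>_ _. 0"] has_derivative_const)
qed simp

lemma Ck_on_bounded_linear: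
  assumes "open S" "bounded_linear L"
  shows "Ck_on k S L"
proof (cases k)
  case 0
  then show ?thesis using assms by (simp add: linear_continuous_on)
next
  case (Suc j)
  show ?thesis
    unfolding Suc using assms
    by (intro Ck_on_SucI[where f' = "\<lambda>_. L"] bounded_linear_imp_has_derivative Ck_on_const)
qed

lemma Ck_on_add:
  assumes "open S" "Ck_on k S f" "Ck_on k S g"
  shows "Ck_on k S (\<lambda>x. f x + g x)"
  using assms(2,3)
proof (induction k arbitrary: f g)
  case 0
  then show ?case by (simp add: continuous_on_add)
next
  case (Suc k)
  show ?case
    by (rule Ck_on_SucI[OF \<open>open S\<close> has_derivative_add[OF Suc.prems[THEN Ck_on_Suc_has_derivative]]])
      (use Suc in simp_all)
qed

lemma Ck_on_bounded_linear_compose: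
  assumes "open S" "bounded_linear L" "Ck_on k S f"
  shows "Ck_on k S (\<lambda>x. L (f x))"
  using assms(3)
proof (induction k arbitrary: f)
  case 0
  then show ?case by (simp add: bounded_linear.continuous_on[OF assms(2)])
next
  case (Suc k)
  show ?case
    by (rule Ck_on_SucI[OF \<open>open S\<close> bounded_linear.has_derivative[OF assms(2)
            Suc.prems[THEN Ck_on_Suc_has_derivative]]])
      (use Suc in simp_all)
qed

lemma Ck_on_bounded_bilinear:
  assumes "open S" "bounded_bilinear h" "Ck_on k S f" "Ck_on k S g"
  shows "Ck_on k S (\<lambda>x. h (f x) (g x))"
  using assms(3,4)
proof (induction k arbitrary: f g)
  case 0
  then show ?case by (simp add: bounded_bilinear.continuous_on[OF assms(2)])
next
  case (Suc k)
  \<comment> \<open>The product rule leaves one factor undifferentiated, which must therefore also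
    belong to the lower class.\<close>
  note D = Suc.prems[THEN Ck_on_Suc_D]
  show ?case
    by (rule Ck_on_SucI[OF \<open>open S\<close> bounded_bilinear.FDERIV[OF assms(2)
            Suc.prems[THEN Ck_on_Suc_has_derivative]]])
      (use Suc.prems D in \<open>auto intro!: Ck_on_add[OF \<open>open S\<close>] Suc.IH\<close>)
qed

lemmas Ck_on_matrix_mult = Ck_on_bounded_bilinear[OF _ bounded_bilinear_matrix_mult]

text \<open>A product rule for a second factor known only to be continuous, as Lyapunov solutions are
  before their differentiability is established.\<close>

lemma has_derivative_bounded_bilinear_vanishing_left:
  fixes f :: "'a::real_normed_vector \<Rightarrow> 'b::real_normed_vector"
  assumes h: "bounded_bilinear h" and f: "(f has_derivative f') (at x)" "f x = 0"
    and g: "isCont g x"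
  shows "((\<lambda>y. h (f y) (g y)) has_derivative (\<lambda>v. h (f' v) (g x))) (at x)"
proof -
  interpret bounded_bilinear h by (rule h)
  obtain C where C: "\<And>a b. norm (h a b) \<le> norm a * norm b * C" "0 < C"
    using pos_bounded by blast
  interpret F: bounded_linear f' using f(1) by (rule has_derivative_bounded_linear)
  obtain D where D: "\<And>v. norm (f' v) \<le> norm v * D" "0 < D" using F.pos_bounded by blast
  have "((\<lambda>y. h (f y) (g x)) has_derivative (\<lambda>v. h (f' v) (g x))) (at x)"
    by (rule bounded_linear.has_derivative[OF bounded_linear_left f(1)])
  \<comment> \<open>Error of freezing \<open>g\<close> at \<open>x\<close>: the first factor is
    \<open>O(|y - x|)\<close> because \<open>f x = 0\<close>, and the second tends to zero by
    continuity alone.\<close>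
  moreover have "((\<lambda>y. h (f y) (g y - g x)) has_derivative (\<lambda>v. 0)) (at x)"
    unfolding has_derivative_at2
  proof (intro conjI bounded_linear_zero)
    have lim1: "(\<lambda>y. (1 / norm (y - x)) *\<^sub>R (f y - f' (y - x))) \<midarrow>x\<rightarrow> 0"
      using f by (simp add: has_derivative_at2 algebra_simps)
    have lim2: "(\<lambda>y. g y - g x) \<midarrow>x\<rightarrow> 0"
      using g by (simp add: isCont_def LIM_zero)
    have "((\<lambda>y. (norm ((1 / norm (y - x)) *\<^sub>R (f y - f' (y - x))) + D) * norm (g y - g x) * C)
        \<longlongrightarrow> (norm (0::'b) + D) * norm (0::'c) * C) (at x)"
      by (intro tendsto_intros lim1 lim2)
    then have lim: "((\<lambda>y. (norm ((1 / norm (y - x)) *\<^sub>R (f y - f' (y - x))) + D) * norm (g y - g x) * C)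
        \<longlongrightarrow> 0) (at x)" by simp
    show "(\<lambda>y. (1 / norm (y - x)) *\<^sub>R (h (f y) (g y - g x) - (h (f x) (g x - g x) + 0))) \<midarrow>x\<rightarrow> 0"
    proof (rule Lim_null_comparison[OF _ lim])
      have "norm ((1 / norm (y - x)) *\<^sub>R h (f y) (g y - g x))
          \<le> (norm ((1 / norm (y - x)) *\<^sub>R (f y - f' (y - x))) + D) * norm (g y - g x) * C"
        if "y \<noteq> x" for y
      proof -
        let ?s = "1 / norm (y - x)"
        have "?s *\<^sub>R f y = ?s *\<^sub>R (f y - f' (y - x)) + ?s *\<^sub>R f' (y - x)"
          by (simp add: scaleR_diff_right)
        moreover have "norm (?s *\<^sub>R f' (y - x)) \<le> D"
          using D(1)[of "y - x"] that by (simp add: field_simps)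
        ultimately have "norm (?s *\<^sub>R f y) \<le> norm (?s *\<^sub>R (f y - f' (y - x))) + D"
          using norm_triangle_ineq[of "?s *\<^sub>R (f y - f' (y - x))" "?s *\<^sub>R f' (y - x)"] by simp
        then have "norm (?s *\<^sub>R f y) * norm (g y - g x) * C
            \<le> (norm (?s *\<^sub>R (f y - f' (y - x))) + D) * norm (g y - g x) * C"
          using C(2) by (intro mult_right_mono) simp_all
        moreover have "norm (?s *\<^sub>R h (f y) (g y - g x)) \<le> norm (?s *\<^sub>R f y) * norm (g y - g x) * C"
          using C(1)[of "?s *\<^sub>R f y" "g y - g x"] by (simp only: scaleR_left)
        ultimately show ?thesis by linarith
      qed
      then show "\<forall>\<^sub>F y in at x. norm ((1 / norm (y - x)) *\<^sub>R (h (f y) (g y - g x) - (h (f x) (g x - g x) + 0)))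
          \<le> (norm ((1 / norm (y - x)) *\<^sub>R (f y - f' (y - x))) + D) * norm (g y - g x) * C"
        by (simp add: eventually_at_filter zero_right)
    qed
  qed
  ultimately have "((\<lambda>y. h (f y) (g x) + h (f y) (g y - g x)) has_derivative
      (\<lambda>v. h (f' v) (g x) + 0)) (at x)"
    by (rule has_derivative_add)
  then show ?thesis by (simp add: diff_right)
qed

section \<open>Smooth dependence of Lyapunov solutions on the gain\<close>

context
  fixes A :: "real^'n^'n" and B :: "real^'m^'n"
begin

lemma powers_vanish_closed_loop: "K \<in> stabilizing_gains A B \<Longrightarrow> powers_vanish (A + B ** K)"
  by (simp add: stabilizing_gains_def powers_vanish_of_spectral_radius)

text \<open>With \<open>M_K = A + B K\<close> and \<open>M_L = A + B L\<close>, this rests on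
  \<open>M_L X M_L^T - M_K X M_K^T = (M_L - M_K) X M_L^T + M_K X (M_L - M_K)^T\<close> and
  \<open>M_L - M_K = B (L - K)\<close>.\<close>

lemma lyap_closed_loop_diff:
  assumes "K \<in> stabilizing_gains A B" "L \<in> stabilizing_gains A B"
  shows "lyap_op (A + B ** K) (lyap (A + B ** L) W - lyap (A + B ** K) Z) =
    W - Z + (B ** (L - K)) ** (lyap (A + B ** L) W ** transpose (A + B ** L))
      + (A + B ** K) ** lyap (A + B ** L) W ** transpose (B ** (L - K))"
proof -
  let ?X = "lyap (A + B ** L) W"
  have "lyap_op (A + B ** K) (?X - lyap (A + B ** K) Z) = lyap_op (A + B ** K) ?X - Z"
    using assms by (simp add: linear_diff[OF linear_lyap_op] lyap_op_lyap powers_vanish_closed_loop)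
  also have "lyap_op (A + B ** K) ?X = lyap_op (A + B ** L) ?X
      + (B ** (L - K)) ** (?X ** transpose (A + B ** L)) + (A + B ** K) ** ?X ** transpose (B ** (L - K))"
    by (simp add: lyap_op_def matrix_mult_algebra matrix_mul_assoc algebra_simps)
  also have "lyap_op (A + B ** L) ?X = W"
    using assms by (simp add: lyap_op_lyap powers_vanish_closed_loop)
  finally show ?thesis by simp
qed

text \<open>An implicit formula for \<open>X\<close> through the fixed linear map
  \<open>lyap (A + B ** K)\<close>. Both correction terms carry the factor \<open>L - K\<close>,
  from which first continuity and then the derivative at \<open>K\<close> are read off.\<close>

lemma lyap_closed_loop_perturb:
  fixes W Z :: "real^'n^'n"
  assumes "K \<in> stabilizing_gains A B" "L \<in> stabilizing_gains A B"
  defines "X \<equiv> lyap (A + B ** L) W"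
  shows "X = lyap (A + B ** K) Z + lyap (A + B ** K)
    (W - Z + (B ** (L - K)) ** (X ** transpose (A + B ** L))
      + (A + B ** K) ** X ** transpose (B ** (L - K)))"
proof -
  have "lyap (A + B ** K) (lyap_op (A + B ** K) (X - lyap (A + B ** K) Z)) = X - lyap (A + B ** K) Z"
    using assms by (intro lyap_eqI) (simp_all add: powers_vanish_closed_loop)
  then show ?thesis
    unfolding X_def lyap_closed_loop_diff[OF assms(1,2)] by simp
qed

text \<open>The corrections are at most \<open>\<eta> L\<close> times \<open>norm (?X L)\<close>,
  itself at most the sought difference plus \<open>norm (?X K)\<close>. Once
  \<open>c * \<eta> L \<le> 1 / 2\<close>, the difference on the right is absorbed into the left, at
  the price of the factor \<open>2\<close>.\<close>

lemma isCont_lyap_closed_loop: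
  assumes K: "K \<in> stabilizing_gains A B" and F: "isCont F K"
  shows "isCont (\<lambda>L. lyap (A + B ** L) (F L)) K"
proof -
  let ?X = "\<lambda>L. lyap (A + B ** L) (F L)"
  let ?MK = "A + B ** K"
  note vanish = powers_vanish_closed_loop[OF K]
  obtain c where c: "0 < c" "\<And>Z. norm (lyap ?MK Z) \<le> norm Z * c"
    using bounded_linear.pos_bounded[OF bounded_linear_lyap[OF vanish]] by blast
  obtain C where C: "0 < C" "\<And>(P :: real^'n^'n) (Q :: real^'n^'n). norm (P ** Q) \<le> norm P * norm Q * C"
    using bounded_bilinear.pos_bounded[OF bounded_bilinear_matrix_mult] by blast
  \<comment> \<open>Bounds both correction terms as linear maps of the solution and vanishes at
    \<open>K\<close>; the two factors \<open>C\<close> come from the triple products.\<close>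
  define \<eta> where "\<eta> L = (norm (B ** (L - K)) * norm (transpose (A + B ** L))
    + norm ?MK * norm (transpose (B ** (L - K)))) * C * C" for L
  have mult3: "norm (P ** (Q ** R)) \<le> norm P * norm Q * norm R * C * C" for P Q R :: "real^'n^'n"
  proof -
    have "norm (P ** (Q ** R)) \<le> norm P * norm (Q ** R) * C" by (rule C)
    also have "\<dots> \<le> norm P * (norm Q * norm R * C) * C"
      using C by (intro mult_right_mono mult_left_mono) simp_all
    finally show ?thesis by (simp add: mult_ac)
  qed
  have "isCont \<eta> K"
    unfolding \<eta>_def
    by (intro continuous_intros bounded_bilinear.isCont[OF bounded_bilinear_matrix_mult]
        bounded_linear.isCont[OF bounded_linear_transpose])
  moreover have "\<eta> K = 0"
    by (simp add: \<eta>_def bounded_bilinear.zero_right[OF bounded_bilinear_matrix_mult]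
        linear_0[OF bounded_linear.linear[OF bounded_linear_transpose]])
  ultimately have \<eta>: "\<eta> \<midarrow>K\<rightarrow> 0" by (simp add: isCont_def)
  have bound: "norm (?X L - ?X K) \<le> 2 * c * (norm (F L - F K) + \<eta> L * norm (?X K))"
    if L: "L \<in> stabilizing_gains A B" and small: "c * \<eta> L \<le> 1 / 2" for L
  proof -
    let ?d = "norm (?X L - ?X K)"
    let ?E1 = "(B ** (L - K)) ** (?X L ** transpose (A + B ** L))"
    let ?E2 = "?MK ** ?X L ** transpose (B ** (L - K))"
    have \<eta>0: "0 \<le> \<eta> L" using C by (simp add: \<eta>_def)
    have "?X L - ?X K = lyap ?MK (F L - F K + ?E1 + ?E2)"
      using lyap_closed_loop_perturb[OF K L, of "F L" "F K"] by (simp add: algebra_simps)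
    then have d: "?d \<le> norm (F L - F K + ?E1 + ?E2) * c" using c(2) by metis
    have "norm (F L - F K + ?E1 + ?E2) \<le> norm (F L - F K) + (norm ?E1 + norm ?E2)"
      using norm_triangle_ineq[of "F L - F K + ?E1" ?E2] norm_triangle_ineq[of "F L - F K" ?E1]
      by linarith
    also have "norm ?E1 + norm ?E2 \<le> \<eta> L * norm (?X L)"
      using mult3[of "B ** (L - K)" "?X L" "transpose (A + B ** L)"]
        mult3[of ?MK "?X L" "transpose (B ** (L - K))"]
      by (simp add: \<eta>_def matrix_mul_assoc algebra_simps)
    also have "\<eta> L * norm (?X L) \<le> \<eta> L * (?d + norm (?X K))"
      using \<eta>0 norm_triangle_sub[of "?X L" "?X K"] by (intro mult_left_mono) simp_all
    finally have "norm (F L - F K + ?E1 + ?E2) * c \<le> (norm (F L - F K) + \<eta> L * (?d + norm (?X K))) * c"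
      using c(1) by (intro mult_right_mono) simp_all
    with d have "?d \<le> (norm (F L - F K) + \<eta> L * (?d + norm (?X K))) * c" by (rule order_trans)
    also have "\<dots> = c * (norm (F L - F K) + \<eta> L * norm (?X K)) + (c * \<eta> L) * ?d"
      by (simp add: algebra_simps)
    also have "(c * \<eta> L) * ?d \<le> 1 / 2 * ?d" using small by (intro mult_right_mono) simp_all
    finally show ?thesis by simp
  qed
  have "(\<lambda>L. c * \<eta> L) \<midarrow>K\<rightarrow> c * 0" by (intro tendsto_intros \<eta>)
  then have "\<forall>\<^sub>F L in at K. c * \<eta> L < 1 / 2" by (rule order_tendstoD) simp
  moreover have "\<forall>\<^sub>F L in at K. L \<in> stabilizing_gains A B"
    using open_stabilizing_gains K by (rule eventually_at_in_open')
  ultimately have ev: "\<forall>\<^sub>F L in at K. norm (?X L - ?X K) \<le> 2 * c * (norm (F L - F K) + \<eta> L * norm (?X K))"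
    by eventually_elim (rule bound, simp_all)
  have "(\<lambda>L. 2 * c * (norm (F L - F K) + \<eta> L * norm (?X K))) \<midarrow>K\<rightarrow>
      2 * c * (norm (F K - F K) + 0 * norm (?X K))"
    using F by (intro tendsto_intros \<eta>) (simp add: isCont_def)
  then have "(\<lambda>L. 2 * c * (norm (F L - F K) + \<eta> L * norm (?X K))) \<midarrow>K\<rightarrow> 0" by simp
  with ev have "(\<lambda>L. ?X L - ?X K) \<midarrow>K\<rightarrow> 0" by (rule Lim_null_comparison)
  then show ?thesis by (simp add: isCont_def LIM_zero_iff)
qed

text \<open>In the perturbation formula each correction pairs a factor vanishing at \<open>K\<close>
  with one that is continuous there, so it is differentiable at \<open>K\<close> before anything is
  known about the derivative of \<open>X\<close>.\<close>

lemma has_derivative_lyap_closed_loop: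
  assumes K: "K \<in> stabilizing_gains A B" and F: "(F has_derivative F') (at K)"
  defines "X \<equiv> \<lambda>L. lyap (A + B ** L) (F L)"
  shows "(X has_derivative (\<lambda>v. lyap (A + B ** K)
    (F' v + (B ** v) ** (X K ** transpose (A + B ** K))
      + (A + B ** K) ** X K ** transpose (B ** v)))) (at K)"
proof -
  let ?MK = "A + B ** K"
  note mult = bounded_bilinear_matrix_mult
  have X: "isCont X K"
    unfolding X_def using has_derivative_continuous[OF F]
    by (intro isCont_lyap_closed_loop K) simp
  have \<Delta>: "((\<lambda>L. B ** (L - K)) has_derivative (\<lambda>v. B ** v)) (at K)"
    by (rule bounded_linear.has_derivative[OF bounded_bilinear.bounded_linear_right[OF mult]])
      (auto intro!: derivative_eq_intros)
  have "isCont (\<lambda>L. X L ** transpose (A + B ** L)) K"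
    by (intro continuous_intros bounded_bilinear.isCont[OF mult] X
        bounded_linear.isCont[OF bounded_linear_transpose])
  then have 1: "((\<lambda>L. (B ** (L - K)) ** (X L ** transpose (A + B ** L))) has_derivative
      (\<lambda>v. (B ** v) ** (X K ** transpose ?MK))) (at K)"
    by (intro has_derivative_bounded_bilinear_vanishing_left[OF mult \<Delta>])
      (simp_all add: bounded_bilinear.zero_right[OF mult])
  have "isCont (\<lambda>L. ?MK ** X L) K"
    by (intro continuous_intros bounded_bilinear.isCont[OF mult] X)
  then have 2: "((\<lambda>L. ?MK ** X L ** transpose (B ** (L - K))) has_derivative
      (\<lambda>v. ?MK ** X K ** transpose (B ** v))) (at K)"
    by (intro has_derivative_bounded_bilinear_vanishing_left[OF bounded_bilinear.flip[OF mult]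
          bounded_linear.has_derivative[OF bounded_linear_transpose \<Delta>]])
      (simp_all add: bounded_bilinear.zero_right[OF mult]
        linear_0[OF bounded_linear.linear[OF bounded_linear_transpose]])
  have FK: "((\<lambda>L. F L - F K) has_derivative F') (at K)"
    using has_derivative_diff[OF F has_derivative_const] by simp
  have "((\<lambda>L. X K + lyap ?MK (F L - F K + (B ** (L - K)) ** (X L ** transpose (A + B ** L))
      + ?MK ** X L ** transpose (B ** (L - K)))) has_derivative (\<lambda>v. 0 + lyap ?MK
    (F' v + (B ** v) ** (X K ** transpose ?MK) + ?MK ** X K ** transpose (B ** v)))) (at K)"
    by (intro has_derivative_add has_derivative_const 1 2 FK
        bounded_linear.has_derivative[OF bounded_linear_lyap[OF powers_vanish_closed_loop[OF K]]])
  then have "((\<lambda>L. X K + lyap ?MK (F L - F K + (B ** (L - K)) ** (X L ** transpose (A + B ** L))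
      + ?MK ** X L ** transpose (B ** (L - K)))) has_derivative (\<lambda>v. lyap ?MK
    (F' v + (B ** v) ** (X K ** transpose ?MK) + ?MK ** X K ** transpose (B ** v)))) (at K)"
    by simp
  then show ?thesis
    by (rule has_derivative_transform_within_open[OF _ open_stabilizing_gains K])
      (simp add: X_def lyap_closed_loop_perturb[OF K, symmetric])
qed

section \<open>Smoothness of all orders\<close>

lemma Ck_on_closed_loop:
  "Ck_on k (stabilizing_gains A B) (\<lambda>K. A + B ** K)"
proof (rule Ck_on_add[OF open_stabilizing_gains])
  show "Ck_on k (stabilizing_gains A B) (\<lambda>K. A)"
    by (rule Ck_on_const[OF open_stabilizing_gains])
  show "Ck_on k (stabilizing_gains A B) (\<lambda>K. B ** K)"
    by (rule Ck_on_bounded_linear[OF open_stabilizing_gains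
          bounded_bilinear.bounded_linear_right[OF bounded_bilinear_matrix_mult]])
qed

text \<open>The derivative is a Lyapunov solution whose right-hand side contains the solution for
  \<open>F\<close>. The induction hypothesis is thus used twice, for \<open>F\<close> and for this
  new right-hand side, which is why \<open>F\<close> is arbitrary.\<close>

lemma Ck_on_lyap_closed_loop:
  assumes "Ck_on k (stabilizing_gains A B) F"
  shows "Ck_on k (stabilizing_gains A B) (\<lambda>K. lyap (A + B ** K) (F K))"
  using assms
proof (induction k arbitrary: F)
  case 0
  then show ?case
    by (simp add: continuous_on_eq_continuous_at open_stabilizing_gains isCont_lyap_closed_loop)
next
  case (Suc k)
  note open_gains = open_stabilizing_gains[of A B]
  have F': "Ck_on k (stabilizing_gains A B) (\<lambda>K. frechet_derivative F (at K) v)" for v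
    using Suc.prems by simp
  note X = Suc.IH[OF Ck_on_Suc_D[OF Suc.prems]]
  show ?case
  proof (rule Ck_on_SucI[OF open_gains])
    show "Ck_on k (stabilizing_gains A B) (\<lambda>K. lyap (A + B ** K)
        (frechet_derivative F (at K) v
          + (B ** v) ** (lyap (A + B ** K) (F K) ** transpose (A + B ** K))
          + (A + B ** K) ** lyap (A + B ** K) (F K) ** transpose (B ** v)))" for v
      by (rule Suc.IH, intro F' X Ck_on_closed_loop Ck_on_add Ck_on_matrix_mult Ck_on_const open_gains
          Ck_on_bounded_linear_compose[OF open_gains bounded_linear_transpose, OF Ck_on_closed_loop])
  qed (rule has_derivative_lyap_closed_loop[OF _ Ck_on_Suc_has_derivative[OF Suc.prems]])
qed

lemma smooth_on_Y_map: "smooth_on (stabilizing_gains A B) (Y_map A B \<Sigma>1 \<Sigma>2)"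
  unfolding smooth_on_def
proof
  fix k
  have "Ck_on k (stabilizing_gains A B) (Sigma_gain \<Sigma>1 \<Sigma>2)"
    unfolding Sigma_gain_def [abs_def]
    by (intro Ck_on_add Ck_on_matrix_mult Ck_on_const open_stabilizing_gains
        Ck_on_bounded_linear[OF open_stabilizing_gains bounded_linear_transpose]
        Ck_on_bounded_linear[OF open_stabilizing_gains bounded_linear_ident])
  then show "Ck_on k (stabilizing_gains A B) (Y_map A B \<Sigma>1 \<Sigma>2)"
    unfolding Y_map_def [abs_def] by (rule Ck_on_lyap_closed_loop)
qed

end

section \<open>The metric and its coefficients\<close>

lemma bounded_linear_trace: "bounded_linear (trace :: real^'n^'n \<Rightarrow> real)"
  unfolding linear_conv_bounded_linear [symmetric]
  by (rule linearI) (simp_all add: trace_def sum.distrib sum_distrib_left)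

section \<open>Matrix inverses and coordinate expansions\<close>

lemma matrix_inv_right_left:
  fixes G :: "real^'n^'n"
  assumes "invertible G"
  shows "G ** matrix_inv G = mat 1" "matrix_inv G ** G = mat 1"
  using someI_ex[OF assms[unfolded invertible_def]] by (simp_all add: matrix_inv_def)

lemma matrix_inv_eqI:
  fixes G H :: "real^'n^'n"
  assumes "G ** H = mat 1"
  shows "invertible G" "matrix_inv G = H"
proof -
  show G: "invertible G" using assms invertible_right_inverse by blast
  show "matrix_inv G = H"
    by (metis G assms matrix_inv_right_left(2) matrix_mul_assoc matrix_mul_lid matrix_mul_rid)
qed

lemma coord_frame_expansion: "V = (\<Sum>p\<in>UNIV. coord_coframe p V *\<^sub>R coord_frame p)"
proof -
  have "(\<Sum>p\<in>UNIV. coord_coframe p V *\<^sub>R coord_frame p) $ i $ j = V $ i $ j" for i j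
  proof -
    have "(\<Sum>p\<in>UNIV. coord_coframe p V *\<^sub>R coord_frame p) $ i $ j
        = (\<Sum>p\<in>UNIV. if p = (i, j) then V $ i $ j else 0)"
      unfolding sum_component
      by (intro sum.cong) (auto simp: coord_coframe_def coord_frame_def)
    then show ?thesis by simp
  qed
  then show ?thesis by (simp add: vec_eq_iff)
qed

lemma bilinear_coord_expansion:
  assumes "bilinear (g K)"
  shows "g K = (\<lambda>V W. \<Sum>p\<in>UNIV. \<Sum>q\<in>UNIV.
    tensor_coeff g p q K * tensor_prod (coord_coframe p) (coord_coframe q) V W)"
proof (intro ext)
  fix V W
  have "g K V W = g K (\<Sum>p\<in>UNIV. coord_coframe p V *\<^sub>R coord_frame p)
      (\<Sum>q\<in>UNIV. coord_coframe q W *\<^sub>R coord_frame q)"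
    by (simp flip: coord_frame_expansion)
  also have "\<dots> = (\<Sum>p\<in>UNIV. \<Sum>q\<in>UNIV.
      g K (coord_coframe p V *\<^sub>R coord_frame p) (coord_coframe q W *\<^sub>R coord_frame q))"
    by (simp add: bilinear_sum[OF assms] sum.cartesian_product)
  also have "\<dots> = (\<Sum>p\<in>UNIV. \<Sum>q\<in>UNIV.
      tensor_coeff g p q K * tensor_prod (coord_coframe p) (coord_coframe q) V W)"
    by (simp add: bilinear_lmul[OF assms] bilinear_rmul[OF assms] tensor_coeff_def
        tensor_prod_def mult_ac)
  finally show "g K V W = \<dots>" .
qed

section \<open>The metric at a point as a form depending only on \<open>Y\<close>\<close>

definition trace_form :: "real^'n^'n \<Rightarrow> real^'n^'m \<Rightarrow> real^'n^'m \<Rightarrow> real" where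
  "trace_form Y V W = trace (transpose V ** W ** Y)"

lemma g_metric_eq_trace_form: "g_metric A B \<Sigma>1 \<Sigma>2 K = trace_form (Y_map A B \<Sigma>1 \<Sigma>2 K)"
  by (simp add: fun_eq_iff g_metric_def trace_form_def Y_map_def)

lemma bilinear_trace_form: "bilinear (trace_form Y)"
  unfolding bilinear_def trace_form_def
proof (intro conjI allI bounded_linear.linear)
  note mult = bounded_bilinear_matrix_mult
  show "bounded_linear (\<lambda>W. trace (transpose V ** W ** Y))" for V
    by (intro bounded_linear_compose[OF bounded_linear_trace]
        bounded_linear_compose[OF bounded_bilinear.bounded_linear_left[OF mult]]
        bounded_bilinear.bounded_linear_right[OF mult])
  show "bounded_linear (\<lambda>V. trace (transpose V ** W ** Y))" for W
    by (intro bounded_linear_compose[OF bounded_linear_trace]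
        bounded_linear_compose[OF bounded_bilinear.bounded_linear_left[OF mult]]
        bounded_linear_transpose)
qed

lemma trace_form_commute:
  assumes "transpose Y = Y"
  shows "trace_form Y V W = trace_form Y W V"
proof -
  have "trace_form Y V W = trace (transpose (transpose V ** W ** Y))"
    by (simp add: trace_form_def trace_def transpose_def)
  also have "\<dots> = trace (Y ** (transpose W ** V))"
    by (simp add: matrix_transpose_mul assms)
  also have "\<dots> = trace_form Y W V"
    unfolding trace_form_def by (rule trace_mul_sym)
  finally show ?thesis .
qed

text \<open>Cyclicity turns the trace into that of \<open>V Y V^T\<close>, the sum of the form of
  \<open>Y\<close> over the rows of \<open>V\<close>, one of which is nonzero.\<close>

lemma trace_form_pos:
  fixes V :: "real^'n^'m"
  assumes Y: "\<And>x. x \<noteq> 0 \<Longrightarrow> 0 < x \<bullet> (Y *v x)" and "V \<noteq> 0"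
  shows "0 < trace_form Y V V"
proof -
  let ?r = "\<lambda>i. transpose V *v axis i 1"
  have nonneg: "0 \<le> x \<bullet> (Y *v x)" for x using Y[of x] by (cases "x = 0") auto
  have "trace_form Y V V = trace (V ** Y ** transpose V)"
    unfolding trace_form_def by (metis matrix_mul_assoc trace_mul_sym)
  also have "\<dots> = (\<Sum>i\<in>UNIV. axis i 1 \<bullet> ((V ** Y ** transpose V) *v axis i 1))"
    by (simp add: trace_def matrix_vector_mult_basis column_def inner_axis')
  also have "\<dots> = (\<Sum>i\<in>UNIV. ?r i \<bullet> (Y *v ?r i))"
    unfolding inner_quadratic_form_mult ..
  finally have eq: "trace_form Y V V = (\<Sum>i\<in>UNIV. ?r i \<bullet> (Y *v ?r i))" .
  obtain i where "?r i \<noteq> 0"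
    using \<open>V \<noteq> 0\<close>
    by (auto simp: matrix_vector_mult_basis column_def transpose_def vec_eq_iff
        simp del: transpose_matrix_vector)
  then show ?thesis
    unfolding eq using Y nonneg by (intro sum_pos2[of _ i]) simp_all
qed

text \<open>For matrix units, \<open>E_ij^T E_kl\<close> is \<open>E_jl\<close> if
  \<open>i = k\<close> and \<open>0\<close> otherwise; the trace of \<open>E_jl Y\<close> is a
  single entry of \<open>Y\<close>.\<close>

lemma trace_form_coord_frame:
  "trace_form Y (coord_frame (i, j)) (coord_frame (k, l)) = (if i = k then Y $ l $ j else 0)"
proof -
  have "transpose (coord_frame (i, j)) ** coord_frame (k, l) =
      (if i = k then coord_frame (j, l) else 0 :: real^'a^'a)" (is "?L = ?R")
  proof -
    have "?L $ a $ b = ?R $ a $ b" for a b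
    proof -
      have "?L $ a $ b = (\<Sum>c\<in>UNIV. if c = i then (if i = k \<and> a = j \<and> b = l then 1 else 0) else 0)"
        unfolding matrix_matrix_mult_def transpose_def coord_frame_def vec_lambda_beta
        by (intro sum.cong) auto
      then show ?thesis by (simp add: coord_frame_def)
    qed
    then show ?thesis by (simp add: vec_eq_iff)
  qed
  moreover have "trace (coord_frame (j, l) ** Y) = Y $ l $ j"
  proof -
    have "(coord_frame (j, l) ** Y) $ a $ a = (if a = j then Y $ l $ a else 0)" for a
    proof -
      have "(coord_frame (j, l) ** Y) $ a $ a
          = (\<Sum>b\<in>UNIV. if b = l then (if a = j then Y $ l $ a else 0) else 0)"
        unfolding matrix_matrix_mult_def coord_frame_def vec_lambda_beta
        by (intro sum.cong) auto
      then show ?thesis by simp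
    qed
    then show ?thesis by (simp add: trace_def)
  qed
  moreover have "trace (0 ** Y) = 0"
    by (simp add: bounded_bilinear.zero_left[OF bounded_bilinear_matrix_mult] trace_def)
  ultimately show ?thesis by (simp add: trace_form_def)
qed

text \<open>The coefficient matrix is block diagonal over the row index with every block equal to
  \<open>Y^T\<close>; the candidate \<open>H\<close> inverts each block.\<close>

lemma matrix_inv_coeff_matrix:
  assumes coeff: "\<And>i j k l. tensor_coeff g (i, j) (k, l) K = (if i = k then Y $ l $ j else 0)"
    and Y: "invertible Y"
  shows "invertible (coeff_matrix g K)"
    and "matrix_inv (coeff_matrix g K) $ (i, j) $ (k, l) =
      (if i = k then matrix_inv Y $ l $ j else 0)"
proof -
  define H :: "real^('a \<times> 'b)^('a \<times> 'b)" where
    "H = (\<chi> p q. if fst p = fst q then matrix_inv Y $ snd q $ snd p else 0)"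
  have "(coeff_matrix g K ** H) $ p $ q = mat 1 $ p $ q" for p q
  proof -
    obtain i j k l where pq: "p = (i, j)" "q = (k, l)" by (metis surj_pair)
    have "(coeff_matrix g K ** H) $ p $ q =
        (\<Sum>r\<in>UNIV \<times> UNIV. tensor_coeff g (i, j) r K * H $ r $ (k, l))"
      by (simp add: matrix_matrix_mult_def coeff_matrix_def pq)
    also have "\<dots> = (\<Sum>a\<in>UNIV. \<Sum>b\<in>UNIV. tensor_coeff g (i, j) (a, b) K * H $ (a, b) $ (k, l))"
      by (simp only: sum.cartesian_product) (simp add: case_prod_beta)
    also have "\<dots> = (\<Sum>a\<in>UNIV. if a = i then (if i = k then \<Sum>b\<in>UNIV. matrix_inv Y $ l $ b * Y $ b $ j else 0) else 0)"
      by (intro sum.cong) (auto simp: coeff H_def mult.commute)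
    also have "\<dots> = (if i = k then (matrix_inv Y ** Y) $ l $ j else 0)"
      by (simp add: matrix_matrix_mult_def)
    also have "\<dots> = mat 1 $ p $ q"
      by (auto simp: matrix_inv_right_left[OF Y] mat_def pq)
    finally show ?thesis .
  qed
  then have "coeff_matrix g K ** H = mat 1" by (simp add: vec_eq_iff)
  from matrix_inv_eqI[OF this] show "invertible (coeff_matrix g K)"
    and "matrix_inv (coeff_matrix g K) $ (i, j) $ (k, l) =
      (if i = k then matrix_inv Y $ l $ j else 0)"
    by (simp_all add: H_def)
qed

lemma smooth_on_trace_form:
  assumes S: "open S" and Y: "smooth_on S Y" and V: "smooth_on S V" and W: "smooth_on S W"
  shows "smooth_on S (\<lambda>K. trace_form (Y K) (V K) (W K))"
  unfolding smooth_on_def trace_form_def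
proof
  fix k
  have Ck: "Ck_on k S Y" "Ck_on k S V" "Ck_on k S W"
    using Y V W by (simp_all add: smooth_on_def)
  have "Ck_on k S (\<lambda>K. transpose (V K) ** W K ** Y K)"
    by (intro Ck_on_matrix_mult S Ck Ck_on_bounded_linear_compose[OF S bounded_linear_transpose])
  then show "Ck_on k S (\<lambda>K. trace (transpose (V K) ** W K ** Y K))"
    by (rule Ck_on_bounded_linear_compose[OF S bounded_linear_trace])
qed

theorem mainTheorem4:
  fixes A :: "real^'n^'n" and B :: "real^'m^'n"
    and \<Sigma>1 :: "real^'n^'n" and \<Sigma>2 :: "real^'m^'m"
  defines "S \<equiv> stabilizing_gains A B"
    and "Y \<equiv> Y_map A B \<Sigma>1 \<Sigma>2"
    and "g \<equiv> g_metric A B \<Sigma>1 \<Sigma>2"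
  assumes stab: "stabilizable A B"
    and Sigma1: "psd \<Sigma>1" and Sigma2: "psd \<Sigma>2"
    and hyp: "\<forall>K\<in>S. psd (Sigma_gain \<Sigma>1 \<Sigma>2 K) \<and>
                controllable (A + B ** K) (psd_sqrt (Sigma_gain \<Sigma>1 \<Sigma>2 K))"
  shows "riemannian_manifold S g \<and>
    (\<forall>K\<in>S. g K = (\<lambda>V W. \<Sum>p\<in>UNIV. \<Sum>q\<in>UNIV.
        tensor_coeff g p q K * tensor_prod (coord_coframe p) (coord_coframe q) V W)) \<and>
    (\<forall>p q. smooth_on S (tensor_coeff g p q)) \<and>
    (\<forall>K\<in>S. \<forall>i j k l. tensor_coeff g (i, j) (k, l) K = (if i = k then Y K $ l $ j else 0)) \<and>
    (\<forall>K\<in>S. invertible (coeff_matrix g K) \<and> invertible (Y K) \<and>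
      (\<forall>i j k l. matrix_inv (coeff_matrix g K) $ (i, j) $ (k, l) =
         (if i = k then matrix_inv (Y K) $ l $ j else 0)))"
proof -
  have open_S: "open S" unfolding S_def by (rule open_stabilizing_gains)
  have g: "g K = trace_form (Y K)" for K
    unfolding g_def Y_def by (rule g_metric_eq_trace_form)
  have bilinear: "bilinear (g K)" for K unfolding g by (rule bilinear_trace_form)
  have smooth_Y: "smooth_on S Y" unfolding S_def Y_def by (rule smooth_on_Y_map)
  have smooth_g: "smooth_on S (\<lambda>K. g K (V K) (W K))" if "smooth_on S V" "smooth_on S W" for V W
    unfolding g using open_S smooth_Y that by (rule smooth_on_trace_form)
  have Y_sym: "transpose (Y K) = Y K" if "K \<in> S" for K
    using that hyp unfolding S_def Y_def Y_map_def
    by (intro transpose_lyap powers_vanish_closed_loop) (simp_all add: psd_def)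
  have Y_pos: "0 < x \<bullet> (Y K *v x)" if "K \<in> S" "x \<noteq> 0" for K x
    using that hyp unfolding S_def Y_def Y_map_def
    by (intro lyap_pos_def powers_vanish_closed_loop) simp_all
  have Y_inv: "invertible (Y K)" if K: "K \<in> S" for K
  proof -
    have "x = 0" if "Y K *v x = 0" for x
      using Y_pos[OF K, of x] that by auto
    then show ?thesis using matrix_left_invertible_ker[of "Y K"] invertible_left_inverse by blast
  qed
  have "0 < g K V V" if "K \<in> S" "V \<noteq> 0" for K V
    unfolding g using Y_pos[OF that(1)] that(2) by (rule trace_form_pos)
  moreover have "g K V W = g K W V" if "K \<in> S" for K V W
    unfolding g using Y_sym[OF that] by (rule trace_form_commute)
  ultimately have "riemannian_manifold S g"
    unfolding riemannian_manifold_def smooth_tensor2_on_def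
    using open_S bilinear smooth_g by blast
  moreover have coeff: "tensor_coeff g (i, j) (k, l) K = (if i = k then Y K $ l $ j else 0)" for i j k l K
    by (simp add: tensor_coeff_def g trace_form_coord_frame)
  \<comment> \<open>The coordinate frame consists of constant, hence smooth, vector fields.\<close>
  moreover have "smooth_on S (tensor_coeff g p q)" for p q
    unfolding tensor_coeff_def
    using open_S by (intro smooth_g) (simp_all add: smooth_on_def Ck_on_const)
  moreover note bilinear_coord_expansion[of g, OF bilinear] Y_inv matrix_inv_coeff_matrix[OF coeff Y_inv]
  ultimately show ?thesis by blast
qed

end
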